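(* For every integer $n\ge 0$: $$\dim(\mathbf{WQSym}^*_n)=\#\{\text{red-packed forests of weight } n\},\qquad \dim(\mathrm{Prim}^*_n)=\#\{\text{red-packed trees of weight } n\},$$ $$\dim(\mathrm{TPrim}^*_n)=\#\{\text{red-packed trees of weight } n \text{ whose root has empty left forest}\}.$$
   Context: Words are finite words over the positive integers; $|w|$ is the length, $\max(w)$ the largest letter ($\max(\varepsilon)=0$). A word $w$ is packed if every integer $1,\dots,\max(w)$ occurs in it ($\varepsilon$ is packed); $\mathrm{PW}_n$ is the set of packed words of length $n$. $\mathrm{pack}(w)$ replaces the $j$-th smallest distinct letter of $w$ by $j$. $\mathbf{WQSym}^*_n$ is the vector space (over a field $K$) with basis $(\mathbb{R}_w)_{w\in\mathrm{PW}_n}$, and $(\mathbf{WQSym}^* )_+=\bigoplus_{n\ge1}\mathbf{WQSym}^*_n$. For $u=u_1\cdots u_n\in\mathrm{PW}_n$, $n\ge1$, define $\Delta_\prec(\mathbb{R}_u)=\sum \mathbb{R}_{\mathrm{pack}(u_1\cdots u_i)}\otimes\mathbb{R}_{\mathrm{pack}(u_{i+1}\cdots u_n)}$ over those $1\le i\le n-1$ with $\{u_1,\dots,u_i\}\cap\{u_{i+1},\dots,u_n\}=\emptyset$ and $\max(u)\in\{u_1,\dots,u_i\}$, and $\Delta_\succ(\mathbb{R}_u)$ the same sum over those $1\le i\le n-1$ with $\{u_1,\dots,u_i\}\cap\{u_{i+1},\dots,u_n\}=\emptyset$ and $\max(u)\notin\{u_1,\dots,u_i\}$; extend linearly. $\mathrm{Prim}^*_n=\mathbf{WQSym}^*_n\cap\ker(\Delta_\prec+\Delta_\succ)$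 and $\mathrm{TPrim}^*_n=\mathbf{WQSym}^*_n\cap\ker\Delta_\prec\cap\ker\Delta_\succ$ for $n\ge1$ (both $0$ for $n=0$). A biplane tree with labels in a set $L$ is recursively $\mathrm{Node}(x,f_\ell,f_r)$ with $x\in L$ the root label and $f_\ell$, $f_r$ (left and right forests) finite ordered, possibly empty, lists of such trees; a forest is a finite ordered list of trees. Red-packed trees have labels that are nonempty finite sets $I=\{i_1<\dots<i_p\}$ of positive integers; the weight is $\omega(\mathrm{Node}(I,f_\ell,f_r))=|I|+$ (sum of weights of the trees of $f_\ell$ and $f_r$), and the weight of a forest is the sum of the weights of its trees. A tree $t=\mathrm{Node}(I,[\ell_1,\dots,\ell_g],[r_1,\dots,r_d])$ with $I=\{i_1<\dots<i_p\}$ is red-packed if all $\ell_j$ and $r_j$ are red-packed and either ($d=0$ and $I=\{1,\dots,p\}$) or ($d\ge1$, $1\le i_1\le\omega(r_1)$ and $1\le p+\omega(r_1)+\dots+\omega(r_d)+1-i_p\le\omega(r_d)$). A red-packed forest is a list of red-packed trees. *)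

theory Defs
  imports Complex_Main "HOL-Library.Poly_Mapping"
begin

definition fscale :: "'k::field \<Rightarrow> ('a \<Rightarrow>\<^sub>0 'k) \<Rightarrow> ('a \<Rightarrow>\<^sub>0 'k)" where
  "fscale c f = Poly_Mapping.map ((*) c) f"

lemma lookup_fscale [simp]: "Poly_Mapping.lookup (fscale c f) x = c * Poly_Mapping.lookup f x"
  by (simp add: fscale_def Poly_Mapping.map.rep_eq when_def)

global_interpretation free_vs: vector_space "fscale :: 'k::field \<Rightarrow> ('a \<Rightarrow>\<^sub>0 'k) \<Rightarrow> ('a \<Rightarrow>\<^sub>0 'k)"
  by unfold_locales (auto intro!: poly_mapping_eqI simp: lookup_add algebra_simps)

definition lin_ext :: "('a \<Rightarrow> ('b \<Rightarrow>\<^sub>0 'k)) \<Rightarrow> ('a \<Rightarrow>\<^sub>0 'k::field) \<Rightarrow> ('b \<Rightarrow>\<^sub>0 'k)" where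
  "lin_ext g f = (\<Sum>u\<in>Poly_Mapping.keys f. fscale (Poly_Mapping.lookup f u) (g u))"

lemma lin_ext_superset:
  assumes "finite A" "Poly_Mapping.keys f \<subseteq> A"
  shows "lin_ext g f = (\<Sum>u\<in>A. fscale (Poly_Mapping.lookup f u) (g u))"
  unfolding lin_ext_def using assms
  by (intro sum.mono_neutral_left) (auto simp: in_keys_iff)

lemma lin_ext_single: "lin_ext g (Poly_Mapping.single u 1) = g u"
  by (simp add: lin_ext_def)

lemma linear_lin_ext:
  fixes g :: "'a \<Rightarrow> ('b \<Rightarrow>\<^sub>0 'k::field)"
  shows "Vector_Spaces.linear fscale fscale (lin_ext g)"
proof unfold_locales
  fix f h :: "'a \<Rightarrow>\<^sub>0 'k" and c :: 'k
  let ?A = "Poly_Mapping.keys f \<union> Poly_Mapping.keys h"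
  have "Poly_Mapping.keys (f + h) \<subseteq> ?A" by (rule keys_add)
  then show "lin_ext g (f + h) = lin_ext g f + lin_ext g h"
    by (simp add: lin_ext_superset[of ?A] lookup_add free_vs.scale_left_distrib sum.distrib)
  have "Poly_Mapping.keys (fscale c f) \<subseteq> Poly_Mapping.keys f" by (auto simp: in_keys_iff)
  then show "lin_ext g (fscale c f) = fscale c (lin_ext g f)"
    by (simp add: lin_ext_superset[of "Poly_Mapping.keys f"] free_vs.scale_sum_right)
qed


definition wmax :: "nat list \<Rightarrow> nat" where
  "wmax w = Max (insert 0 (set w))"

definition packed :: "nat list \<Rightarrow> bool" where
  "packed w \<longleftrightarrow> set w = {1..wmax w}"

definition PW :: "nat \<Rightarrow> nat list set" where
  "PW n = {w. packed w \<and> length w = n}"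

definition pack :: "nat list \<Rightarrow> nat list" where
  "pack w = map (\<lambda>x. card {y \<in> set w. y \<le> x}) w"

definition RW :: "nat list \<Rightarrow> (nat list \<Rightarrow>\<^sub>0 'k::field)" where
  "RW w = Poly_Mapping.single w 1"

definition WQSym_dual :: "nat \<Rightarrow> (nat list \<Rightarrow>\<^sub>0 'k::field) set" where
  "WQSym_dual n = free_vs.span (RW ` PW n)"

text \<open>The tensor square of a free vector space on \<open>'a\<close> is the free vector space on \<open>'a \<times> 'a\<close>;
  \<open>RR u v\<close> is the elementary tensor \<open>RW u \<otimes> RW v\<close>.\<close>

definition RR :: "nat list \<Rightarrow> nat list \<Rightarrow> (nat list \<times> nat list \<Rightarrow>\<^sub>0 'k::field)" where
  "RR u v = Poly_Mapping.single (u, v) 1"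

definition left_cuts :: "nat list \<Rightarrow> nat set" where
  "left_cuts u = {i. 1 \<le> i \<and> i < length u \<and> set (take i u) \<inter> set (drop i u) = {}
     \<and> wmax u \<in> set (take i u)}"

definition right_cuts :: "nat list \<Rightarrow> nat set" where
  "right_cuts u = {i. 1 \<le> i \<and> i < length u \<and> set (take i u) \<inter> set (drop i u) = {}
     \<and> wmax u \<notin> set (take i u)}"

definition Delta_prec :: "(nat list \<Rightarrow>\<^sub>0 'k::field) \<Rightarrow> (nat list \<times> nat list \<Rightarrow>\<^sub>0 'k)" where
  "Delta_prec = lin_ext (\<lambda>u. \<Sum>i\<in>left_cuts u. RR (pack (take i u)) (pack (drop i u)))"

definition Delta_succ :: "(nat list \<Rightarrow>\<^sub>0 'k::field) \<Rightarrow> (nat list \<times> nat list \<Rightarrow>\<^sub>0 'k)" where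
  "Delta_succ = lin_ext (\<lambda>u. \<Sum>i\<in>right_cuts u. RR (pack (take i u)) (pack (drop i u)))"

definition Prim_dual :: "nat \<Rightarrow> (nat list \<Rightarrow>\<^sub>0 'k::field) set" where
  "Prim_dual n = (if n = 0 then {0}
     else {f \<in> WQSym_dual n. Delta_prec f + Delta_succ f = 0})"

definition TPrim_dual :: "nat \<Rightarrow> (nat list \<Rightarrow>\<^sub>0 'k::field) set" where
  "TPrim_dual n = (if n = 0 then {0}
     else {f \<in> WQSym_dual n. Delta_prec f = 0 \<and> Delta_succ f = 0})"


datatype 'l biplane_tree =
  Node (root_label: 'l) (left_forest: "'l biplane_tree list") (right_forest: "'l biplane_tree list")

fun weight :: "nat set biplane_tree \<Rightarrow> nat" where
  "weight (Node I ls rs) = card I + sum_list (map weight ls) + sum_list (map weight rs)"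

definition forest_weight :: "nat set biplane_tree list \<Rightarrow> nat" where
  "forest_weight ts = sum_list (map weight ts)"

text \<open>The second inequality chain is stated over the integers because of the subtraction.\<close>

fun red_packed :: "nat set biplane_tree \<Rightarrow> bool" where
  "red_packed (Node I ls rs) \<longleftrightarrow>
     finite I \<and> I \<noteq> {} \<and> 0 \<notin> I \<and>
     (\<forall>t\<in>set ls. red_packed t) \<and> (\<forall>t\<in>set rs. red_packed t) \<and>
     (rs = [] \<and> I = {1..card I} \<or>
      rs \<noteq> [] \<and>
      1 \<le> Min I \<and> Min I \<le> weight (hd rs) \<and>
      1 \<le> int (card I) + int (forest_weight rs) + 1 - int (Max I) \<and>
      int (card I) + int (forest_weight rs) + 1 - int (Max I) \<le> int (weight (last rs)))"

definition red_packed_forest :: "nat set biplane_tree list \<Rightarrow> bool" where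
  "red_packed_forest ts \<longleftrightarrow> (\<forall>t\<in>set ts. red_packed t)"

end

theory Submission
  imports Defs
begin

text \<open>
  Removing the maximal letters of a packed word, at positions \<open>J\<close>, leaves a shorter packed word, which
  by induction encodes a forest. Cutting this forest at the first and the last position of \<open>J\<close> gives
  \<open>ls @ rs @ ts\<close>, and the word encodes \<open>Node I ls rs # ts\<close> with \<open>I\<close> the shift of \<open>J\<close>. This is a
  bijection from red-packed forests to packed words; concatenation of forests corresponds to placing
  the letters of the first word above those of the second.

  Dually to the two half-coproducts, packed words carry two half-products satisfying the dendriform
  axioms, and \<open>Prim\<close> and \<open>TPrim\<close> are the solution spaces of \<open>f (u * v) = 0\<close>, respectively of
  \<open>f (u \<prec> v) = f (u \<succ> v) = 0\<close>. By associativity, the equations for \<open>[t] * ts\<close> with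
  \<open>ts\<close> nonempty, respectively for \<open>ls \<succ> Node I [] rs \<prec> ts\<close> with \<open>ls\<close> or \<open>ts\<close> nonempty, imply
  all the others. The word of the forest \<open>t # ts\<close>, respectively \<open>Node I ls rs # ts\<close>, is the unique term
  with the most inversions in the corresponding product, so this reduced system is triangular, and its
  solutions are parametrised by the forests that are not pivots: the single trees, respectively the
  single trees with empty left forest.
\<close>

section \<open>Packing and dendriform products\<close>

definition rank_in :: "nat list \<Rightarrow> nat \<Rightarrow> nat" where
  "rank_in w x = card {y \<in> set w. y \<le> x}"

lemma pack_eq_map_rank_in: "pack w = map (rank_in w) w"
  by (simp add: pack_def rank_in_def)

lemma length_pack [simp]: "length (pack w) = length w"
  by (simp add: pack_def)

lemma wmax_Nil [simp]: "wmax [] = 0"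
  by (simp add: wmax_def)

lemma wmax_append [simp]: "wmax (p @ q) = max (wmax p) (wmax q)"
proof -
  have "insert 0 (set (p @ q)) = insert 0 (set p) \<union> insert 0 (set q)" by auto
  then show ?thesis unfolding wmax_def by (subst \<open>insert 0 (set (p @ q)) = _\<close>, subst Max_Un) auto
qed

lemma le_wmax: "x \<in> set w \<Longrightarrow> x \<le> wmax w"
  by (simp add: wmax_def)

lemma wmax_in: "wmax w \<in> insert 0 (set w)"
  unfolding wmax_def by (rule Max_in) auto

lemma packedI: "set w = {1..k} \<Longrightarrow> packed w"
proof -
  assume w: "set w = {1..k}"
  then have "wmax w = k" unfolding wmax_def w by (intro Max_eqI) auto
  with w show ?thesis by (simp add: packed_def)
qed

lemma packed_pos: "packed w \<Longrightarrow> 0 \<notin> set w"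
  by (auto simp: packed_def)

lemma pack_packed: "packed w \<Longrightarrow> pack w = w"
proof -
  assume "packed w"
  then have w: "set w = {1..wmax w}" by (simp add: packed_def)
  have "card {y \<in> set w. y \<le> x} = x" if "x \<in> set w" for x
  proof -
    have "{y \<in> set w. y \<le> x} = {1..x}" using that w by auto
    then show ?thesis by simp
  qed
  then show ?thesis by (simp add: pack_def map_idI)
qed

text \<open>Strictly increasing relabellings, of which \<open>rank_in w\<close> is the main example.
  The value 0 is included, with \<open>g 0 = 0\<close>, because \<open>wmax [] = 0\<close>; thus
  \<open>g\<close> commutes with \<open>wmax\<close> on the empty word too.\<close>

definition mono_word_map :: "nat list \<Rightarrow> (nat \<Rightarrow> nat) \<Rightarrow> bool" where
  "mono_word_map w g \<longleftrightarrow> 0 \<notin> set w \<and> g 0 = 0 \<and>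
     (\<forall>x \<in> insert 0 (set w). \<forall>y \<in> insert 0 (set w). x < y \<longrightarrow> g x < g y)"

lemma mono_word_map_less:
  "mono_word_map w g \<Longrightarrow> x \<in> insert 0 (set w) \<Longrightarrow> y \<in> insert 0 (set w) \<Longrightarrow> g x < g y \<longleftrightarrow> x < y"
  unfolding mono_word_map_def by (metis less_asym' linorder_neqE_nat)

lemma mono_word_map_le:
  "mono_word_map w g \<Longrightarrow> x \<in> insert 0 (set w) \<Longrightarrow> y \<in> insert 0 (set w) \<Longrightarrow> g x \<le> g y \<longleftrightarrow> x \<le> y"
  using mono_word_map_less[of w g y x] by (meson linorder_not_less)

lemma mono_word_map_inj: "mono_word_map w g \<Longrightarrow> inj_on g (insert 0 (set w))"
  by (rule inj_onI) (metis mono_word_map_less linorder_neqE_nat less_irrefl)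

lemma mono_word_map_subset: "mono_word_map w g \<Longrightarrow> set v \<subseteq> set w \<Longrightarrow> mono_word_map v g"
  unfolding mono_word_map_def by blast

lemma mono_word_map_pos: "mono_word_map w g \<Longrightarrow> 0 \<notin> set (map g w)"
  unfolding mono_word_map_def by fastforce

lemma mono_word_map_rank_in: "0 \<notin> set w \<Longrightarrow> mono_word_map w (rank_in w)"
proof -
  assume 0: "0 \<notin> set w"
  have "rank_in w x < rank_in w y" if "y \<in> insert 0 (set w)" "x < y" for x y
  proof -
    have "y \<in> set w" using that by auto
    \<comment> \<open>The letter \<open>y\<close> is counted in its own rank but not in the rank of
      the smaller \<open>x\<close>, so the inclusion is strict.\<close>
    then have "y \<in> {z \<in> set w. z \<le> y} - {z \<in> set w. z \<le> x}" using that by auto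
    then have "{z \<in> set w. z \<le> x} \<noteq> {z \<in> set w. z \<le> y}" by blast
    then have "{z \<in> set w. z \<le> x} \<subset> {z \<in> set w. z \<le> y}" using that(2) by force
    then show ?thesis unfolding rank_in_def by (intro psubset_card_mono) auto
  qed
  moreover have "rank_in w 0 = 0" using 0 by (auto simp: rank_in_def)
  ultimately show ?thesis using 0 by (auto simp: mono_word_map_def)
qed

lemma pack_map: "mono_word_map w g \<Longrightarrow> pack (map g w) = pack w"
proof -
  assume g: "mono_word_map w g"
  have "card {y \<in> set (map g w). y \<le> g x} = card {y \<in> set w. y \<le> x}" if "x \<in> set w" for x
  proof -
    have "{y \<in> set (map g w). y \<le> g x} = g ` {y \<in> set w. y \<le> x}"
      using that mono_word_map_le[OF g] by auto
    moreover have "inj_on g {y \<in> set w. y \<le> x}"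
      by (rule inj_on_subset[OF mono_word_map_inj[OF g]]) auto
    ultimately show ?thesis by (simp add: card_image)
  qed
  then show ?thesis by (simp add: pack_def)
qed

lemma wmax_map: "mono_word_map w g \<Longrightarrow> wmax (map g w) = g (wmax w)"
proof -
  assume g: "mono_word_map w g"
  have "g y \<le> g (wmax w)" if "y \<in> set w" for y
    using that mono_word_map_le[OF g, of y "wmax w"] wmax_in[of w] le_wmax by auto
  moreover have "g (wmax w) \<in> insert 0 (set (map g w))"
    using wmax_in[of w] g by (auto simp: mono_word_map_def)
  ultimately show ?thesis unfolding wmax_def[of "map g w"] by (intro Max_eqI) auto
qed

text \<open>The ranks lie between 1 and the number of distinct letters and are pairwise distinct, so
  by counting they fill this interval.\<close>

lemma packed_pack: "0 \<notin> set w \<Longrightarrow> packed (pack w)"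
proof (rule packedI)
  assume 0: "0 \<notin> set w"
  note g = mono_word_map_rank_in[OF 0]
  have "rank_in w ` set w \<subseteq> {1..card (set w)}"
  proof (rule image_subsetI)
    fix x assume "x \<in> set w"
    then have "rank_in w x \<noteq> 0" using mono_word_map_pos[OF g] by (metis image_eqI set_map)
    moreover have "rank_in w x \<le> card (set w)"
      unfolding rank_in_def by (intro card_mono) auto
    ultimately show "rank_in w x \<in> {1..card (set w)}" by simp
  qed
  moreover have "card (rank_in w ` set w) = card (set w)"
    by (rule card_image, rule inj_on_subset[OF mono_word_map_inj[OF g]]) auto
  ultimately show "set (pack w) = {1..card (set w)}"
    unfolding pack_eq_map_rank_in by (simp add: card_subset_eq)
qed

lemma pack_nth_less:
  assumes "0 \<notin> set w" "i < length w" "j < length w"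
  shows "pack w ! i < pack w ! j \<longleftrightarrow> w ! i < w ! j"
  using mono_word_map_less[OF mono_word_map_rank_in[OF assms(1)], of "w ! i" "w ! j"] assms
  by (simp add: pack_eq_map_rank_in)

lemma pack_eqI:
  assumes "length x = length y"
    and "\<And>i j. i < length x \<Longrightarrow> j < length x \<Longrightarrow> x ! i \<le> x ! j \<longleftrightarrow> y ! i \<le> y ! j"
  shows "pack x = pack y"
proof (rule nth_equalityI)
  fix i assume "i < length (pack x)"
  then have i: "i < length x" by simp
  let ?J = "{j. j < length x \<and> x ! j \<le> x ! i}"
  have X: "{z \<in> set x. z \<le> x ! i} = (!) x ` ?J" using i by (auto simp: in_set_conv_nth)
  have Y: "{z \<in> set y. z \<le> y ! i} = (!) y ` ?J" using i assms by (auto simp: in_set_conv_nth)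
  \<comment> \<open>\<open>h\<close> sends a letter of \<open>x\<close> to the letter of
    \<open>y\<close> in the same position. Equal letters of \<open>x\<close> sit over equal letters
    of \<open>y\<close>, so the chosen position does not matter.\<close>
  define h where "h z = y ! (SOME j. j < length x \<and> x ! j = z)" for z
  have h: "h (x ! j) = y ! j" if "j < length x" for j
  proof -
    define k where "k = (SOME k. k < length x \<and> x ! k = x ! j)"
    have "k < length x \<and> x ! k = x ! j"
      unfolding k_def by (rule someI[of _ j]) (use that in auto)
    then have "y ! k = y ! j" using assms(2)[of k j] assms(2)[of j k] that by simp
    then show ?thesis by (simp add: h_def k_def)
  qed
  have "(!) y ` ?J = h ` (!) x ` ?J" unfolding image_image using h by auto
  moreover have "inj_on h ((!) x ` ?J)"
  proof (rule inj_onI)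
    fix a b assume "a \<in> (!) x ` ?J" "b \<in> (!) x ` ?J" and e: "h a = h b"
    then obtain j k where "j < length x" "k < length x" "a = x ! j" "b = x ! k" by auto
    then show "a = b" using e h assms(2)[of j k] assms(2)[of k j] by simp
  qed
  ultimately have "card ((!) y ` ?J) = card ((!) x ` ?J)" by (simp add: card_image)
  then show "pack x ! i = pack y ! i" using i assms(1) by (simp add: pack_def X Y)
qed (use assms in simp)

text \<open>Packing a concatenation relabels both factors by one increasing map, which preserves
  their packings, their disjointness and the comparison of their maxima.\<close>

lemma pack_append_split:
  assumes "0 \<notin> set (p @ q)"
  obtains g where "pack (p @ q) = map g p @ map g q"
    "packed (map g p @ map g q)" "pack (map g p) = pack p" "pack (map g q) = pack q"
    "set (map g p) \<inter> set (map g q) = {} \<longleftrightarrow> set p \<inter> set q = {}"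
    "wmax (map g p) < wmax (map g q) \<longleftrightarrow> wmax p < wmax q"
    "wmax (map g q) < wmax (map g p) \<longleftrightarrow> wmax q < wmax p"
proof
  let ?g = "rank_in (p @ q)"
  note g = mono_word_map_rank_in[OF assms]
  have gp: "mono_word_map p ?g" and gq: "mono_word_map q ?g" by (rule mono_word_map_subset[OF g]; simp)+
  show e: "pack (p @ q) = map ?g p @ map ?g q" by (simp add: pack_eq_map_rank_in)
  show "packed (map ?g p @ map ?g q)" using packed_pack[OF assms] e by simp
  show "pack (map ?g p) = pack p" "pack (map ?g q) = pack q" using pack_map gp gq by auto
  have "inj_on ?g (set p \<union> set q)" by (rule inj_on_subset[OF mono_word_map_inj[OF g]]) auto
  then show "set (map ?g p) \<inter> set (map ?g q) = {} \<longleftrightarrow> set p \<inter> set q = {}"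
    by (auto simp: inj_on_def disjoint_iff)
  show "wmax (map ?g p) < wmax (map ?g q) \<longleftrightarrow> wmax p < wmax q"
    "wmax (map ?g q) < wmax (map ?g p) \<longleftrightarrow> wmax q < wmax p"
    using wmax_in[of p] wmax_in[of q]
    by (auto simp: wmax_map[OF gp] wmax_map[OF gq] intro!: mono_word_map_less[OF g])
qed

section \<open>Products dual to cutting a word in two or three factors\<close>

text \<open>The relation \<open>c\<close> compares the maxima of the two factors; as they have no letter in common, it
  expresses which factor contains the maximum of the word.\<close>

definition cut_prod :: "(nat \<Rightarrow> nat \<Rightarrow> bool) \<Rightarrow> nat list \<Rightarrow> nat list \<Rightarrow> nat list set" where
  "cut_prod c u v = {p @ q | p q. packed (p @ q) \<and> set p \<inter> set q = {} \<and> pack p = u \<and> pack q = v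
     \<and> c (wmax p) (wmax q)}"

text \<open>A threefold product carrying one condition on all three maxima. Both bracketings of an
  iterated product are expressed by it, so each associativity law reduces to an equivalence of such
  conditions.\<close>

definition cut_prod3 ::
    "(nat \<Rightarrow> nat \<Rightarrow> nat \<Rightarrow> bool) \<Rightarrow> nat list \<Rightarrow> nat list \<Rightarrow> nat list \<Rightarrow> nat list set" where
  "cut_prod3 c u v z = {p @ q @ r | p q r. packed (p @ q @ r) \<and>
     set p \<inter> set q = {} \<and> set p \<inter> set r = {} \<and> set q \<inter> set r = {} \<and>
     pack p = u \<and> pack q = v \<and> pack r = z \<and> c (wmax p) (wmax q) (wmax r)}"

text \<open>These comparisons depend only on the relative order of the maxima, so they survive
  increasing relabellings.\<close>

definition order_cond :: "(nat \<Rightarrow> nat \<Rightarrow> bool) \<Rightarrow> bool" where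
  "order_cond c \<longleftrightarrow> c = (\<lambda>_ _. True) \<or> c = (<) \<or> c = (>)"

lemma order_cond_simps [simp]: "order_cond (\<lambda>_ _. True)" "order_cond (<)" "order_cond (>)"
  by (auto simp: order_cond_def)

lemma cut_prod_subset: "cut_prod c u v \<subseteq> PW (length u + length v)"
  by (auto simp: cut_prod_def PW_def)

lemma cut_prod3_subset: "cut_prod3 c u v z \<subseteq> PW (length u + length v + length z)"
  by (auto simp: cut_prod3_def PW_def)

lemma finite_PW: "finite (PW n)"
proof (rule finite_subset)
  show "PW n \<subseteq> {w. set w \<subseteq> {1..n} \<and> length w = n}"
  proof
    fix w assume "w \<in> PW n"
    then have w: "set w = {1..wmax w}" "length w = n" by (auto simp: PW_def packed_def)
    \<comment> \<open>The maximum of a packed word is its number of distinct letters, hence at most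
      its length.\<close>
    then have "wmax w \<le> n" using card_length[of w] by simp
    then show "w \<in> {w. set w \<subseteq> {1..n} \<and> length w = n}" using w by auto
  qed
qed (rule finite_lists_length_eq, simp)

lemma finite_cut_prod [simp]: "finite (cut_prod c u v)"
  by (rule finite_subset[OF cut_prod_subset finite_PW])

lemma finite_cut_prod3 [simp]: "finite (cut_prod3 c u v z)"
  by (rule finite_subset[OF cut_prod3_subset finite_PW])

text \<open>Lifts a factorisation of the packed word to the word itself: cut \<open>s\<close> at the
  same place and undo the relabelling.\<close>

lemma pack_eq_append_split:
  assumes "0 \<notin> set s" "pack s = p' @ q'"
  obtains p q where "s = p @ q" "pack p = pack p'" "pack q = pack q'"
    "set p' \<inter> set q' = {} \<longleftrightarrow> set p \<inter> set q = {}"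
    "\<And>c. order_cond c \<Longrightarrow> c (wmax p') (wmax q') \<longleftrightarrow> c (wmax p) (wmax q)"
proof -
  define p q where "p = take (length p') s" and "q = drop (length p') s"
  then have s: "s = p @ q" by simp
  have "length s = length p' + length q'" using assms(2) by (metis length_append length_pack)
  then have lp: "length p = length p'" by (simp add: p_def)
  obtain g where g: "pack (p @ q) = map g p @ map g q" "pack (map g p) = pack p" "pack (map g q) = pack q"
    "set (map g p) \<inter> set (map g q) = {} \<longleftrightarrow> set p \<inter> set q = {}"
    "wmax (map g p) < wmax (map g q) \<longleftrightarrow> wmax p < wmax q"
    "wmax (map g q) < wmax (map g p) \<longleftrightarrow> wmax q < wmax p"
    using pack_append_split[of p q] assms(1) s by metis
  then have "p' = map g p" "q' = map g q" using lp assms(2) s by simp_all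
  with g show ?thesis by (intro that[of p q]) (auto simp: s order_cond_def)
qed

text \<open>The inner condition is tested on the packed prefix, the outer one on the word. Since
  \<open>c\<close> ignores increasing relabellings and the maximum of a concatenation is the larger
  of the two maxima, both can be read off the three factors.\<close>

lemma cut_prod3_left:
  assumes "order_cond c"
  shows "(\<Union>x \<in> cut_prod c u v. cut_prod d x z)
    = cut_prod3 (\<lambda>i j k. c i j \<and> d (max i j) k) u v z" (is "?L = ?R")
proof (intro equalityI subsetI)
  fix w assume "w \<in> ?L"
  then obtain s r p' q' where w: "w = s @ r" "packed (s @ r)" "set s \<inter> set r = {}" "pack s = p' @ q'"
    "pack r = z" "d (wmax s) (wmax r)" "set p' \<inter> set q' = {}" "pack p' = u" "pack q' = v"
    "c (wmax p') (wmax q')"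
    by (auto simp: cut_prod_def)
  have "0 \<notin> set s" using packed_pos[OF w(2)] by simp
  from pack_eq_append_split[OF this w(4)] obtain p q where "s = p @ q" "pack p = pack p'" "pack q = pack q'"
    "set p \<inter> set q = {}" "c (wmax p) (wmax q)" using w(7,10) assms by metis
  then show "w \<in> ?R" using w unfolding cut_prod3_def by (intro CollectI exI[of _ p] exI[of _ q] exI[of _ r]) auto
next
  fix w assume "w \<in> ?R"
  then obtain p q r where w: "w = p @ q @ r" "packed (p @ q @ r)" "set p \<inter> set q = {}"
    "set p \<inter> set r = {}" "set q \<inter> set r = {}" "pack p = u" "pack q = v" "pack r = z"
    "c (wmax p) (wmax q)" "d (max (wmax p) (wmax q)) (wmax r)"
    by (auto simp: cut_prod3_def)
  have "0 \<notin> set (p @ q)" using packed_pos[OF w(2)] by simp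
  then obtain g where g: "pack (p @ q) = map g p @ map g q"
    "packed (map g p @ map g q)" "pack (map g p) = pack p" "pack (map g q) = pack q"
    "set (map g p) \<inter> set (map g q) = {} \<longleftrightarrow> set p \<inter> set q = {}"
    "wmax (map g p) < wmax (map g q) \<longleftrightarrow> wmax p < wmax q"
    "wmax (map g q) < wmax (map g p) \<longleftrightarrow> wmax q < wmax p"
    using pack_append_split[of p q] by metis
  have "c (wmax (map g p)) (wmax (map g q))" using assms w(9) g(6,7) by (auto simp: order_cond_def)
  then have "pack (p @ q) \<in> cut_prod c u v" unfolding cut_prod_def g(1) using g w by blast
  moreover have "w \<in> cut_prod d (pack (p @ q)) z"
    unfolding cut_prod_def using w by (intro CollectI exI[of _ "p @ q"] exI[of _ r]) auto
  ultimately show "w \<in> ?L" by blast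
qed

lemma cut_prod3_right:
  assumes "order_cond c"
  shows "(\<Union>y \<in> cut_prod c v z. cut_prod d u y)
    = cut_prod3 (\<lambda>i j k. c j k \<and> d i (max j k)) u v z" (is "?L = ?R")
proof (intro equalityI subsetI)
  fix w assume "w \<in> ?L"
  then obtain s r p' q' where w: "w = r @ s" "packed (r @ s)" "set r \<inter> set s = {}" "pack s = p' @ q'"
    "pack r = u" "d (wmax r) (wmax s)" "set p' \<inter> set q' = {}" "pack p' = v" "pack q' = z"
    "c (wmax p') (wmax q')"
    by (auto simp: cut_prod_def)
  have "0 \<notin> set s" using packed_pos[OF w(2)] by simp
  from pack_eq_append_split[OF this w(4)] obtain p q where "s = p @ q" "pack p = pack p'" "pack q = pack q'"
    "set p \<inter> set q = {}" "c (wmax p) (wmax q)" using w(7,10) assms by metis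
  then show "w \<in> ?R" using w unfolding cut_prod3_def by (intro CollectI exI[of _ r] exI[of _ p] exI[of _ q]) auto
next
  fix w assume "w \<in> ?R"
  then obtain p q r where w: "w = p @ q @ r" "packed (p @ q @ r)" "set p \<inter> set q = {}"
    "set p \<inter> set r = {}" "set q \<inter> set r = {}" "pack p = u" "pack q = v" "pack r = z"
    "c (wmax q) (wmax r)" "d (wmax p) (max (wmax q) (wmax r))"
    by (auto simp: cut_prod3_def)
  have "0 \<notin> set (q @ r)" using packed_pos[OF w(2)] by simp
  then obtain g where g: "pack (q @ r) = map g q @ map g r"
    "packed (map g q @ map g r)" "pack (map g q) = pack q" "pack (map g r) = pack r"
    "set (map g q) \<inter> set (map g r) = {} \<longleftrightarrow> set q \<inter> set r = {}"
    "wmax (map g q) < wmax (map g r) \<longleftrightarrow> wmax q < wmax r"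
    "wmax (map g r) < wmax (map g q) \<longleftrightarrow> wmax r < wmax q"
    using pack_append_split[of q r] by metis
  have "c (wmax (map g q)) (wmax (map g r))" using assms w(9) g(6,7) by (auto simp: order_cond_def)
  then have "pack (q @ r) \<in> cut_prod c v z" unfolding cut_prod_def g(1) using g w by blast
  moreover have "w \<in> cut_prod d u (pack (q @ r))"
    unfolding cut_prod_def using w by (intro CollectI exI[of _ p] exI[of _ "q @ r"]) auto
  ultimately show "w \<in> ?L" by blast
qed

lemma cut_prod_factors:
  assumes "w \<in> cut_prod c u v"
  shows "u = pack (take (length u) w)" "v = pack (drop (length u) w)" "length w = length u + length v"
    "packed u" "packed v" "packed w"
  using assms by (auto simp: cut_prod_def intro!: packed_pack dest: packed_pos)

text \<open>The union over \<open>x\<close> is disjoint: all \<open>x\<close> have the same length,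
  so \<open>x\<close> is recovered from a term as the packing of its prefix of that length.\<close>

lemma sum_cut_prod3_left:
  assumes "order_cond c"
  shows "sum f (cut_prod3 (\<lambda>i j k. c i j \<and> d (max i j) k) u v z)
    = (\<Sum>x \<in> cut_prod c u v. sum f (cut_prod d x z))"
proof -
  have "cut_prod d x z \<inter> cut_prod d y z = {}"
    if "x \<in> cut_prod c u v" "y \<in> cut_prod c u v" "x \<noteq> y" for x y
    using that cut_prod_factors(1,3) by (metis disjoint_iff)
  then show ?thesis unfolding cut_prod3_left[OF assms, symmetric]
    by (intro sum.UNION_disjoint) auto
qed

lemma sum_cut_prod3_right:
  assumes "order_cond c"
  shows "sum f (cut_prod3 (\<lambda>i j k. c j k \<and> d i (max j k)) u v z)
    = (\<Sum>y \<in> cut_prod c v z. sum f (cut_prod d u y))"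
proof -
  have "cut_prod d u x \<inter> cut_prod d u y = {}"
    if "x \<in> cut_prod c v z" "y \<in> cut_prod c v z" "x \<noteq> y" for x y
    using that cut_prod_factors(2) by (metis disjoint_iff)
  then show ?thesis unfolding cut_prod3_right[OF assms, symmetric]
    by (intro sum.UNION_disjoint) auto
qed

section \<open>The associative product, its two halves and the dendriform axioms\<close>

abbreviation "full_prod \<equiv> cut_prod (\<lambda>_ _. True)"
abbreviation "prec_prod \<equiv> cut_prod (>)"
abbreviation "succ_prod \<equiv> cut_prod (<)"
abbreviation "mid_prod \<equiv> cut_prod3 (\<lambda>i j k. i < j \<and> k < j)"

lemma sum_full_assoc:
  "(\<Sum>x \<in> full_prod u v. sum f (full_prod x z)) = (\<Sum>y \<in> full_prod v z. sum f (full_prod u y))"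
  using sum_cut_prod3_left[of "\<lambda>_ _. True" f "\<lambda>_ _. True" u v z]
    sum_cut_prod3_right[of "\<lambda>_ _. True" f "\<lambda>_ _. True" u v z] by simp

text \<open>The axiom (u \<prec> v) \<prec> z = u \<prec> (v * z) under a linear functional: on both
  sides the first maximum exceeds the other two.\<close>

lemma sum_prec_prec:
  "(\<Sum>x \<in> prec_prod u v. sum f (prec_prod x z)) = (\<Sum>y \<in> full_prod v z. sum f (prec_prod u y))"
proof -
  have e: "(\<lambda>i j k. j < i \<and> k < max i j) = (\<lambda>i j k :: nat. True \<and> max j k < i)"
    by (auto simp: fun_eq_iff)
  show ?thesis
    using sum_cut_prod3_left[of "(>)" f "(>)" u v z]
      sum_cut_prod3_right[of "\<lambda>_ _. True" f "(>)" u v z] by (simp add: e)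
qed

text \<open>With \<open>sum_mid_right\<close>, this is the axiom (u \<succ> v) \<prec> z = u \<succ>
  (v \<prec> z): in both bracketings the middle maximum is the largest.\<close>

lemma sum_mid_left: "sum f (mid_prod u v z) = (\<Sum>x \<in> succ_prod u v. sum f (prec_prod x z))"
proof -
  have e: "(\<lambda>i j k. i < j \<and> k < max i j) = (\<lambda>i j k :: nat. i < j \<and> k < j)"
    by (auto simp: fun_eq_iff)
  show ?thesis using sum_cut_prod3_left[of "(<)" f "(>)" u v z] by (simp add: e)
qed

lemma sum_mid_right: "sum f (mid_prod u v z) = (\<Sum>y \<in> prec_prod v z. sum f (succ_prod u y))"
proof -
  have e: "(\<lambda>i j k. k < j \<and> i < max j k) = (\<lambda>i j k :: nat. i < j \<and> k < j)"
    by (auto simp: fun_eq_iff)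
  show ?thesis using sum_cut_prod3_right[of "(>)" f "(<)" u v z] by (simp add: e)
qed

lemma sum_succ_succ:
  "(\<Sum>x \<in> full_prod u v. sum f (succ_prod x z)) = (\<Sum>y \<in> succ_prod v z. sum f (succ_prod u y))"
proof -
  have e: "(\<lambda>i j k. j < k \<and> i < max j k) = (\<lambda>i j k :: nat. True \<and> max i j < k)"
    by (auto simp: fun_eq_iff)
  show ?thesis
    using sum_cut_prod3_right[of "(<)" f "(<)" u v z]
      sum_cut_prod3_left[of "\<lambda>_ _. True" f "(<)" u v z] by (simp add: e)
qed

text \<open>A right factor is absorbed: (a \<succ> t \<prec> b) \<prec> v = a \<succ> t \<prec> (b *
  v).\<close>

lemma sum_mid_prec:
  "(\<Sum>x \<in> mid_prod a t b. sum f (prec_prod x v)) = (\<Sum>y \<in> full_prod b v. sum f (mid_prod a t y))"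
  unfolding sum_mid_left sum_prec_prec by (rule sum.swap)

text \<open>A left factor is absorbed: u \<succ> (a \<succ> t \<prec> b) = (u * a) \<succ> t \<prec>
  b.\<close>

lemma sum_succ_mid:
  "(\<Sum>y \<in> mid_prod a t b. sum f (succ_prod u y)) = (\<Sum>x \<in> full_prod u a. sum f (mid_prod x t b))"
  unfolding sum_mid_left sum_mid_right[symmetric]
  unfolding sum_succ_succ sum_mid_left by simp

section \<open>Leading terms with respect to inversions\<close>

definition inversions :: "nat list \<Rightarrow> (nat \<times> nat) set" where
  "inversions w = {(i, j). i < j \<and> j < length w \<and> w ! j < w ! i}"

lemma finite_inversions [simp]: "finite (inversions w)"
  by (rule finite_subset[of _ "{..<length w} \<times> {..<length w}"]) (auto simp: inversions_def)

text \<open>Containment of inversion sets together with the same pattern of equal letters. Given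
  that pattern, the inversions determine the relative order of all letters.\<close>

definition inv_dominated :: "nat list \<Rightarrow> nat list \<Rightarrow> bool" where
  "inv_dominated x r \<longleftrightarrow> length x = length r \<and> (\<forall>j < length x. \<forall>i < j.
     (x ! j < x ! i \<longrightarrow> r ! j < r ! i) \<and> (x ! i = x ! j \<longleftrightarrow> r ! i = r ! j))"

lemma inv_dominated_pack_eq:
  assumes "pack x = pack r" "0 \<notin> set x" "0 \<notin> set r"
  shows "inv_dominated x r"
proof -
  have l: "length x = length r" using assms(1) by (metis length_pack)
  have lt: "x ! i < x ! j \<longleftrightarrow> r ! i < r ! j" if "i < length x" "j < length x" for i j
    using that pack_nth_less[OF assms(2), of i j] pack_nth_less[OF assms(3), of i j] l assms(1) by simp
  have "(x ! j < x ! i \<longrightarrow> r ! j < r ! i) \<and> (x ! i = x ! j \<longleftrightarrow> r ! i = r ! j)"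
    if "i < j" "j < length x" for i j
    using lt[of i j] lt[of j i] that by auto
  then show ?thesis unfolding inv_dominated_def using l by blast
qed

text \<open>Only inversions across the cut have to be compared; disjointness rules out equal letters
  across it.\<close>

lemma inv_dominated_append:
  assumes "inv_dominated p a" "inv_dominated q b" "set p \<inter> set q = {}" "set a \<inter> set b = {}"
    and "\<And>i j. i < length p \<Longrightarrow> j < length q \<Longrightarrow> q ! j < p ! i \<Longrightarrow> b ! j < a ! i"
  shows "inv_dominated (p @ q) (a @ b)"
proof -
  have l: "length p = length a" "length q = length b" using assms(1,2) by (auto simp: inv_dominated_def)
  have pq: "p ! i \<noteq> q ! j" "a ! i \<noteq> b ! j" if "i < length p" "j < length q" for i j
    using assms(3,4) that l by (metis disjoint_iff nth_mem)+
  show ?thesis unfolding inv_dominated_def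
  proof (intro conjI allI impI)
    show "length (p @ q) = length (a @ b)" using l by simp
  next
    fix j i assume j: "j < length (p @ q)" and i: "i < j" and lt: "(p @ q) ! j < (p @ q) ! i"
    consider "j < length p" | "i < length p" "length p \<le> j" | "length p \<le> i" by linarith
    then show "(a @ b) ! j < (a @ b) ! i"
    proof cases
      case 1
      then show ?thesis using assms(1) i lt l by (simp add: nth_append inv_dominated_def)
    next
      case 2
      then show ?thesis using assms(5)[of i "j - length p"] j lt l by (simp add: nth_append)
    next
      case 3
      then have "j - length p < length q" "i - length p < j - length p" using i j by auto
      then show ?thesis using 3 assms(2) i lt l by (simp add: nth_append inv_dominated_def)
    qed
  next
    fix j i assume j: "j < length (p @ q)" and i: "i < j"
    consider "j < length p" | "i < length p" "length p \<le> j" | "length p \<le> i" by linarith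
    then show "(p @ q) ! i = (p @ q) ! j \<longleftrightarrow> (a @ b) ! i = (a @ b) ! j"
    proof cases
      case 1
      then show ?thesis using assms(1) i l by (simp add: nth_append inv_dominated_def)
    next
      case 2
      then show ?thesis using pq[of i "j - length p"] j l by (simp add: nth_append)
    next
      case 3
      then have "j - length p < length q" "i - length p < j - length p" using i j by auto
      then show ?thesis using 3 assms(2) i l by (simp add: nth_append inv_dominated_def)
    qed
  qed
qed

text \<open>If the inversion sets agreed, the two words would have the same relative order, hence
  the same packing, and packed words are their own packing.\<close>

lemma inv_dominated_less:
  assumes "inv_dominated x r" "packed x" "packed r" "x \<noteq> r"
  shows "card (inversions x) < card (inversions r)"
proof (rule psubset_card_mono)
  have l: "length x = length r" using assms(1) by (simp add: inv_dominated_def)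
  have sub: "inversions x \<subseteq> inversions r"
    using assms(1) by (auto simp: inv_dominated_def inversions_def)
  have False if e: "inversions x = inversions r"
  proof -
    have lt: "x ! j < x ! i \<longleftrightarrow> r ! j < r ! i" "x ! i = x ! j \<longleftrightarrow> r ! i = r ! j"
      if "i < j" "j < length x" for i j
    proof -
      have "(i, j) \<in> inversions x \<longleftrightarrow> (i, j) \<in> inversions r" using e by simp
      then show "x ! j < x ! i \<longleftrightarrow> r ! j < r ! i" using that l by (simp add: inversions_def)
      show "x ! i = x ! j \<longleftrightarrow> r ! i = r ! j" using that assms(1) by (simp add: inv_dominated_def)
    qed
    have "x ! i \<le> x ! j \<longleftrightarrow> r ! i \<le> r ! j" if "i < length x" "j < length x" for i j
    proof (rule linorder_cases[of i j])
      assume "i < j"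
      then show ?thesis using lt[of i j] that by linarith
    next
      assume "j < i"
      then show ?thesis using lt[of j i] that by linarith
    qed simp
    then have "pack x = pack r" using l by (intro pack_eqI) auto
    then show False using assms by (simp add: pack_packed)
  qed
  with sub show "inversions x \<subset> inversions r" by blast
qed simp

text \<open>Within each factor the relative order is prescribed by \<open>u\<close> and
  \<open>v\<close>, and in \<open>a @ b\<close> every pair across the cut is an inversion, so no
  other term can have more.\<close>

lemma full_prod_leading:
  assumes r: "packed (a @ b)" "\<And>x y. x \<in> set a \<Longrightarrow> y \<in> set b \<Longrightarrow> y < x" and "pack a = u" "pack b = v"
  shows "a @ b \<in> full_prod u v"
    and "x \<in> full_prod u v \<Longrightarrow> x \<noteq> a @ b \<Longrightarrow> card (inversions x) < card (inversions (a @ b))"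
proof -
  have ab: "set a \<inter> set b = {}" using r(2) by blast
  then show "a @ b \<in> full_prod u v" using assms by (auto simp: cut_prod_def)
  assume "x \<in> full_prod u v" and ne: "x \<noteq> a @ b"
  then obtain p q where x: "x = p @ q" "packed (p @ q)" "set p \<inter> set q = {}" "pack p = u" "pack q = v"
    by (auto simp: cut_prod_def)
  have "length p = length a" "length q = length b" using x assms by (metis length_pack)+
  then have "inv_dominated x (a @ b)" unfolding x(1)
    using x ab assms packed_pos[OF x(2)] packed_pos[OF r(1)]
    by (intro inv_dominated_append inv_dominated_pack_eq) auto
  then show "card (inversions x) < card (inversions (a @ b))"
    using inv_dominated_less x r ne by simp
qed

text \<open>Every pair across the cuts is an inversion of \<open>a @ b @ c\<close>, except those
  formed by a letter of \<open>a\<close> and the maximum of \<open>b\<close>. The latter are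
  inversions of no term, since the middle maximum always exceeds the first factor.\<close>

lemma mid_prod_leading:
  assumes r: "packed (a @ b @ c)"
    and ab: "\<And>x y. x \<in> set a \<Longrightarrow> y \<in> set b \<Longrightarrow> y \<noteq> wmax b \<Longrightarrow> y < x"
    and ac: "\<And>x y. x \<in> set a \<Longrightarrow> y \<in> set c \<Longrightarrow> y < x"
    and bc: "\<And>x y. x \<in> set b \<Longrightarrow> y \<in> set c \<Longrightarrow> y < x"
    and wm: "wmax a < wmax b" "wmax c < wmax b"
    and pk: "pack a = u" "pack b = v" "pack c = z"
  shows "a @ b @ c \<in> mid_prod u v z"
    and "x \<in> mid_prod u v z \<Longrightarrow> x \<noteq> a @ b @ c \<Longrightarrow>
      card (inversions x) < card (inversions (a @ b @ c))"
proof -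
  have "y \<noteq> x" if "x \<in> set a" "y \<in> set b" for x y
    using ab[OF that] le_wmax[OF that(1)] wm(1) by (cases "y = wmax b") auto
  then have dis: "set a \<inter> set b = {}" "set a \<inter> set c = {}" "set b \<inter> set c = {}"
    using ac bc by blast+
  show "a @ b @ c \<in> mid_prod u v z" using r dis wm pk unfolding cut_prod3_def by blast
  assume "x \<in> mid_prod u v z" and ne: "x \<noteq> a @ b @ c"
  then obtain p q s where x: "x = p @ q @ s" "packed (p @ q @ s)"
    "set p \<inter> set q = {}" "set p \<inter> set s = {}" "set q \<inter> set s = {}"
    "pack p = u" "pack q = v" "pack s = z" "wmax p < wmax q" "wmax s < wmax q"
    by (auto simp: cut_prod3_def)
  have l: "length p = length a" "length q = length b" "length s = length c"
    using x pk by (metis length_pack)+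
  have p0: "0 \<notin> set p" "0 \<notin> set q" "0 \<notin> set s" using packed_pos[OF x(2)] by auto
  have r0: "0 \<notin> set a" "0 \<notin> set b" "0 \<notin> set c" using packed_pos[OF r] by auto
  \<comment> \<open>As \<open>q\<close> and \<open>b\<close> have the same packing, their maxima
    stand in the same positions.\<close>
  have top: "q ! j = wmax q" if "j < length q" "b ! j = wmax b" for j
  proof -
    have "wmax q \<in> set q" using wmax_in[of q] x(9) by auto
    then obtain k where k: "k < length q" "q ! k = wmax q" by (auto simp: in_set_conv_nth)
    have "\<not> b ! j < b ! k" using that(2) k(1) l le_wmax[of "b ! k" b] by simp
    then have "\<not> q ! j < q ! k"
      using that(1) k(1) l pack_nth_less[OF p0(2), of j k] pack_nth_less[OF r0(2), of j k] x(7) pk(2) by simp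
    then show ?thesis using k le_wmax[of "q ! j" q] that(1) by simp
  qed
  have "inv_dominated (q @ s) (b @ c)"
    using x dis pk p0 r0 l bc by (intro inv_dominated_append inv_dominated_pack_eq) auto
  then have "inv_dominated x (a @ b @ c)" unfolding x(1)
  proof (rule inv_dominated_append[rotated])
    show "inv_dominated p a" using x pk p0 r0 by (intro inv_dominated_pack_eq) auto
    show "set p \<inter> set (q @ s) = {}" "set a \<inter> set (b @ c) = {}" using x dis by auto
    fix i j assume i: "i < length p" and j: "j < length (q @ s)" and lt: "(q @ s) ! j < p ! i"
    show "(b @ c) ! j < a ! i"
    proof (cases "j < length q")
      case True
      have "p ! i < wmax q" using le_wmax[of "p ! i" p] i x(9) by simp
      then have "b ! j \<noteq> wmax b" using top[OF True] lt True by (auto simp: nth_append)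
      then show ?thesis using ab[of "a ! i" "b ! j"] i True l by (simp add: nth_append)
    next
      case False
      then show ?thesis using ac[of "a ! i" "c ! (j - length b)"] i j l by (simp add: nth_append)
    qed
  qed
  then show "card (inversions x) < card (inversions (a @ b @ c))"
    using inv_dominated_less x r ne by simp
qed

section \<open>Words of red-packed forests\<close>

fun weave :: "nat \<Rightarrow> bool list \<Rightarrow> nat list \<Rightarrow> nat list" where
  "weave m [] w = []"
| "weave m (True # bs) w = m # weave m bs w"
| "weave m (False # bs) w = hd w # weave m bs (tl w)"

lemma length_weave [simp]: "length (weave m bs w) = length bs"
  by (induction m bs w rule: weave.induct) auto

lemma weave_append:
  "length (filter Not bs) = length w \<Longrightarrow>
    weave m (bs @ bs') (w @ w') = weave m bs w @ weave m bs' w'"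
  by (induction m bs w rule: weave.induct) (auto simp: Suc_length_conv)

lemma weave_replicate_False: "weave m (replicate (length w) False) w = w"
  by (induction w) auto

lemma weave_map:
  "length (filter Not bs) = length w \<Longrightarrow> weave (g m) bs (map g w) = map g (weave m bs w)"
  by (induction m bs w rule: weave.induct) (auto simp: Suc_length_conv)

lemma set_weave:
  "length (filter Not bs) = length w \<Longrightarrow> True \<in> set bs \<Longrightarrow> set (weave m bs w) = insert m (set w)"
proof -
  have "set (weave m bs w) = (if True \<in> set bs then insert m (set w) else set w)"
    if "length (filter Not bs) = length w"
    using that by (induction m bs w rule: weave.induct) (auto simp: Suc_length_conv)
  then show "length (filter Not bs) = length w \<Longrightarrow> True \<in> set bs \<Longrightarrow> set (weave m bs w) = insert m (set w)"
    by simp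
qed

text \<open>With the next two lemmas: weaving in a new letter is inverse to recording its positions
  and erasing it.\<close>

lemma weave_positions:
  "length (filter Not bs) = length w \<Longrightarrow> m \<notin> set w \<Longrightarrow> map (\<lambda>x. x = m) (weave m bs w) = bs"
  by (induction m bs w rule: weave.induct) (auto simp: Suc_length_conv)

lemma weave_rest:
  "length (filter Not bs) = length w \<Longrightarrow> m \<notin> set w \<Longrightarrow> filter (\<lambda>x. x \<noteq> m) (weave m bs w) = w"
  by (induction m bs w rule: weave.induct) (auto simp: Suc_length_conv)

lemma weave_unweave: "weave m (map (\<lambda>x. x = m) w) (filter (\<lambda>x. x \<noteq> m) w) = w"
  by (induction w) auto

definition position_bits :: "nat set \<Rightarrow> nat \<Rightarrow> bool list" where
  "position_bits J n = map (\<lambda>i. i \<in> J) [1..<Suc n]"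

lemma length_position_bits [simp]: "length (position_bits J n) = n"
  by (simp add: position_bits_def)

lemma position_bits_nth: "i < n \<Longrightarrow> position_bits J n ! i \<longleftrightarrow> Suc i \<in> J"
  by (simp add: position_bits_def del: upt_Suc)

lemma position_bits_inj:
  assumes "J \<subseteq> {1..n}" "J' \<subseteq> {1..n}" "position_bits J n = position_bits J' n"
  shows "J = J'"
proof -
  have "i \<in> J \<longleftrightarrow> i \<in> J'" if "i \<in> {1..n}" for i
    using position_bits_nth[of "i - 1" n J] position_bits_nth[of "i - 1" n J'] assms(3) that by auto
  then show ?thesis using assms(1,2) by blast
qed

lemma position_bits_False:
  assumes "J \<subseteq> {1..n}"
  shows "length (filter Not (position_bits J n)) = n - card J"
proof -
  have "length (filter Not (position_bits J n)) = card {i. i < n \<and> Suc i \<notin> J}"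
    by (simp add: length_filter_conv_card position_bits_nth cong: conj_cong)
  also have "\<dots> = card (Suc ` {i. i < n \<and> Suc i \<notin> J})" by (simp add: card_image)
  also have "Suc ` {i. i < n \<and> Suc i \<notin> J} = {1..n} - J"
  proof (intro equalityI subsetI)
    fix k assume "k \<in> {1..n} - J"
    then show "k \<in> Suc ` {i. i < n \<and> Suc i \<notin> J}" by (intro image_eqI[of _ _ "k - 1"]) auto
  qed auto
  also have "card ({1..n} - J) = n - card J"
    using assms by (simp add: card_Diff_subset finite_subset)
  finally show ?thesis .
qed

lemma True_in_position_bits: "J \<subseteq> {1..n} \<Longrightarrow> J \<noteq> {} \<Longrightarrow> True \<in> set (position_bits J n)"
  by (force simp: position_bits_def simp del: upt_Suc)

text \<open>For a root, \<open>a\<close> is the weight of the left forest, \<open>b\<close> that of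
  the root and its right forest, and \<open>c\<close> that of the trees to the right.\<close>

lemma position_bits_shift:
  assumes "I \<subseteq> {1..b}"
  shows "position_bits ((+) a ` I) (a + b + c) = replicate a False @ position_bits I b @ replicate c False"
proof (rule nth_equalityI)
  fix i assume "i < length (position_bits ((+) a ` I) (a + b + c))"
  then have i: "i < a + b + c" by simp
  have "Suc i \<in> (+) a ` I \<longleftrightarrow> a \<le> i \<and> Suc (i - a) \<in> I"
  proof
    assume "Suc i \<in> (+) a ` I"
    then obtain k where "k \<in> I" "Suc i = a + k" by auto
    moreover have "1 \<le> k" using assms \<open>k \<in> I\<close> by auto
    ultimately show "a \<le> i \<and> Suc (i - a) \<in> I" by (auto simp: Suc_diff_le[symmetric])
  next
    assume "a \<le> i \<and> Suc (i - a) \<in> I"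
    then show "Suc i \<in> (+) a ` I" by (intro image_eqI[of _ _ "Suc (i - a)"]) auto
  qed
  moreover have "Suc (i - a) \<notin> I" if "a + b \<le> i" using assms that by auto
  ultimately show "position_bits ((+) a ` I) (a + b + c) ! i
      = (replicate a False @ position_bits I b @ replicate c False) ! i"
    using i by (auto simp: position_bits_nth nth_append)
qed simp

section \<open>Weights and the red-packed condition\<close>

lemma forest_weight_simps [simp]:
  "forest_weight [] = 0" "forest_weight (t # ts) = weight t + forest_weight ts"
  "forest_weight (ts @ us) = forest_weight ts + forest_weight us"
  by (simp_all add: forest_weight_def)

lemma weight_Node: "weight (Node I ls rs) = card I + forest_weight ls + forest_weight rs"
  by (simp add: forest_weight_def)

lemma red_packed_forest_simps [simp]:
  "red_packed_forest []" "red_packed_forest (t # ts) \<longleftrightarrow> red_packed t \<and> red_packed_forest ts"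
  "red_packed_forest (ts @ us) \<longleftrightarrow> red_packed_forest ts \<and> red_packed_forest us"
  by (auto simp: red_packed_forest_def)

text \<open>The root condition over the natural numbers: the subtrahend changes sides, and
  \<open>1 \<le> Min I\<close> is covered by \<open>0 \<notin> I\<close>.\<close>

lemma red_packed_Node:
  "red_packed (Node I ls rs) \<longleftrightarrow> finite I \<and> I \<noteq> {} \<and> 0 \<notin> I \<and>
     red_packed_forest ls \<and> red_packed_forest rs \<and>
     (rs = [] \<and> I = {1..card I} \<or>
      rs \<noteq> [] \<and> Min I \<le> weight (hd rs) \<and> Max I \<le> card I + forest_weight rs \<and>
      card I + forest_weight rs + 1 \<le> Max I + weight (last rs))"
proof (cases "finite I \<and> I \<noteq> {} \<and> 0 \<notin> I")
  case True
  then have "1 \<le> Min I" by (metis Min_in less_one not_le)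
  moreover have "1 \<le> int (card I) + int (forest_weight rs) + 1 - int (Max I) \<longleftrightarrow>
      Max I \<le> card I + forest_weight rs"
    "int (card I) + int (forest_weight rs) + 1 - int (Max I) \<le> int (weight (last rs)) \<longleftrightarrow>
      card I + forest_weight rs + 1 \<le> Max I + weight (last rs)"
    by linarith+
  ultimately show ?thesis unfolding red_packed.simps red_packed_forest_def by blast
next
  case False
  then show ?thesis unfolding red_packed.simps by blast
qed

declare weight.simps [simp del] red_packed.simps [simp del]

lemma red_packed_label_subset:
  assumes "red_packed (Node I ls rs)"
  shows "I \<subseteq> {1..card I + forest_weight rs}"
proof
  fix i assume i: "i \<in> I"
  have I: "finite I" "0 \<notin> I" using assms by (auto simp: red_packed_Node)
  have "i \<noteq> 0" using i I by metis
  moreover have "i \<le> Max I" using i I by simp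
  moreover have "I = {1..card I} \<or> Max I \<le> card I + forest_weight rs"
    using assms unfolding red_packed_Node by blast
  ultimately show "i \<in> {1..card I + forest_weight rs}"
    using i by (metis atLeastAtMost_iff le_trans less_one not_le trans_le_add1)
qed

text \<open>The condition on the label involves only the right forest, so the left forest can be
  detached.\<close>

lemma red_packed_NodeD:
  assumes "red_packed (Node I ls rs)"
  shows "red_packed (Node I [] rs)" "red_packed_forest ls" "red_packed_forest rs"
  using assms red_packed_forest_simps(1) unfolding red_packed_Node by blast+

lemma red_packed_weight_pos: "red_packed t \<Longrightarrow> 0 < weight t"
  by (cases t) (auto simp: red_packed_Node weight_Node card_gt_0_iff)

section \<open>The word of a forest as a leading term\<close>

fun forest_word :: "nat set biplane_tree list \<Rightarrow> nat list" where
  "forest_word [] = []"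
| "forest_word (Node I ls rs # ts) =
    (let w = forest_word (ls @ rs @ ts)
     in weave (Suc (wmax w)) (position_bits ((+) (forest_weight ls) ` I) (card I + length w)) w)"

declare forest_word.simps(2) [simp del]

lemma length_forest_word [simp]: "length (forest_word ts) = forest_weight ts"
  by (induction ts rule: forest_word.induct) (auto simp: forest_word.simps(2) Let_def weight_Node)

lemma forest_word_eq_Nil_iff: "red_packed_forest ts \<Longrightarrow> forest_word ts = [] \<longleftrightarrow> ts = []"
proof -
  assume "red_packed_forest ts"
  then have "forest_weight ts = 0 \<longleftrightarrow> ts = []" by (cases ts) (auto dest: red_packed_weight_pos)
  then show ?thesis by (metis length_forest_word length_0_conv)
qed

lemma wmax_insert: "set v = insert m (set w) \<Longrightarrow> wmax v = max m (wmax w)"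
proof -
  assume v: "set v = insert m (set w)"
  have "insert 0 (set v) = insert m (insert 0 (set w))" using v by auto
  then show ?thesis unfolding wmax_def by simp
qed

text \<open>The new maximal letters fall in the segment of the root and its right forest; the
  letters of \<open>ls\<close> before it and of \<open>ts\<close> after it stay contiguous. The
  counts show that \<open>weave\<close> uses up its word exactly.\<close>

lemma root_bits:
  fixes ls rs ts :: "nat set biplane_tree list"
  assumes "red_packed (Node I ls rs)"
  defines "bs \<equiv> position_bits ((+) (forest_weight ls) ` I) (card I + forest_weight (ls @ rs @ ts))"
  shows "bs = replicate (forest_weight ls) False @ position_bits I (card I + forest_weight rs)
              @ replicate (forest_weight ts) False"
    and "length (filter Not bs) = forest_weight (ls @ rs @ ts)"
    and "length (filter Not (position_bits I (card I + forest_weight rs))) = forest_weight rs"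
    and "True \<in> set bs" "True \<in> set (position_bits I (card I + forest_weight rs))"
proof -
  have I: "I \<subseteq> {1..card I + forest_weight rs}" using red_packed_label_subset[OF assms(1)] .
  have e: "card I + forest_weight (ls @ rs @ ts)
    = forest_weight ls + (card I + forest_weight rs) + forest_weight ts" by simp
  show b: "bs = replicate (forest_weight ls) False @ position_bits I (card I + forest_weight rs)
              @ replicate (forest_weight ts) False"
    unfolding bs_def e by (rule position_bits_shift[OF I])
  show c: "length (filter Not (position_bits I (card I + forest_weight rs))) = forest_weight rs"
    by (simp add: position_bits_False[OF I])
  then show "length (filter Not bs) = forest_weight (ls @ rs @ ts)" unfolding b by simp
  have "I \<noteq> {}" using assms(1) by (simp add: red_packed_Node)
  then show d: "True \<in> set (position_bits I (card I + forest_weight rs))"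
    by (rule True_in_position_bits[OF I])
  show "True \<in> set bs" unfolding b using d by simp
qed

lemma set_forest_word_Cons:
  assumes "red_packed (Node I ls rs)"
  shows "set (forest_word (Node I ls rs # ts))
    = insert (Suc (wmax (forest_word (ls @ rs @ ts)))) (set (forest_word (ls @ rs @ ts)))"
  using root_bits(2,4)[OF assms, of ts] by (simp add: forest_word.simps(2) Let_def set_weave)

lemma packed_forest_word: "red_packed_forest ts \<Longrightarrow> packed (forest_word ts)"
proof (induction ts rule: forest_word.induct)
  case 1
  show ?case by (simp add: packed_def)
next
  case (2 I ls rs ts)
  then have "packed (forest_word (ls @ rs @ ts))" by (auto simp: red_packed_Node)
  then have "set (forest_word (ls @ rs @ ts)) = {1..wmax (forest_word (ls @ rs @ ts))}"
    by (simp add: packed_def)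
  then have "set (forest_word (Node I ls rs # ts)) = {1..Suc (wmax (forest_word (ls @ rs @ ts)))}"
    using set_forest_word_Cons[of I ls rs ts] 2(2) by auto
  then show ?case by (rule packedI)
qed

lemma wmax_forest_word_Cons:
  assumes "red_packed (Node I ls rs)"
  shows "wmax (forest_word (Node I ls rs # ts)) = Suc (wmax (forest_word (ls @ rs @ ts)))"
  using wmax_insert[OF set_forest_word_Cons[OF assms]] by simp

lemma wmax_map_add: "w \<noteq> [] \<Longrightarrow> wmax (map ((+) k) w) = k + wmax w"
proof -
  assume "w \<noteq> []"
  then have "Max (set w) + k = Max ((\<lambda>x. x + k) ` set w)"
    using Max_add_commute[of "set w" "\<lambda>x. x" k] by simp
  moreover have "(\<lambda>x. x + k) ` set w = set (map ((+) k) w)" by auto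
  ultimately show ?thesis using \<open>w \<noteq> []\<close> by (simp add: wmax_def)
qed

text \<open>Induction on the removal of roots from \<open>ts\<close>: in the longer forest the new
  maximum is the shifted one, and the bit list is merely padded with \<open>False\<close> over the
  letters of \<open>us\<close>.\<close>

lemma forest_word_append:
  assumes "red_packed_forest (ts @ us)"
  shows "forest_word (ts @ us) = map ((+) (wmax (forest_word us))) (forest_word ts) @ forest_word us"
  using assms
proof (induction ts rule: forest_word.induct)
  case (2 I ls rs ts)
  let ?k = "wmax (forest_word us)" and ?w = "forest_word (ls @ rs @ ts)"
  have N: "red_packed (Node I ls rs)" using 2 by simp
  have IH: "forest_word (ls @ rs @ ts @ us) = map ((+) ?k) ?w @ forest_word us"
    using 2 by (simp add: red_packed_Node)
  \<comment> \<open>The empty word is treated apart: shifting it does not raise its maximum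
    0.\<close>
  have m: "Suc (wmax (map ((+) ?k) ?w @ forest_word us)) = ?k + Suc (wmax ?w)"
    by (cases "?w = []") (auto simp: wmax_map_add)
  let ?bs = "position_bits ((+) (forest_weight ls) ` I) (card I + forest_weight (ls @ rs @ ts))"
  have bs: "position_bits ((+) (forest_weight ls) ` I) (card I + forest_weight (ls @ rs @ ts @ us))
    = ?bs @ replicate (forest_weight us) False"
    using root_bits(1)[OF N, of ts] root_bits(1)[OF N, of "ts @ us"]
    by (simp add: replicate_add)
  have "forest_word (Node I ls rs # ts @ us)
    = weave (?k + Suc (wmax ?w)) (?bs @ replicate (forest_weight us) False)
        (map ((+) ?k) ?w @ forest_word us)"
    using bs unfolding forest_word.simps(2) Let_def IH m by (simp add: add.assoc)
  also have "\<dots> = weave (?k + Suc (wmax ?w)) ?bs (map ((+) ?k) ?w) @ forest_word us"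
    using root_bits(2)[OF N, of ts] weave_replicate_False[of _ "forest_word us"]
    by (subst weave_append) auto
  also have "\<dots> = map ((+) ?k) (forest_word (Node I ls rs # ts)) @ forest_word us"
    using root_bits(2)[OF N, of ts] by (subst weave_map) (auto simp: forest_word.simps(2) Let_def)
  finally show ?case by simp
qed simp

lemma pack_map_add: "0 \<notin> set w \<Longrightarrow> pack (map ((+) k) w) = pack w"
proof -
  assume "0 \<notin> set w"
  \<comment> \<open>The shift is altered at 0, which is not a letter, to satisfy
    \<open>g 0 = 0\<close>.\<close>
  then have "mono_word_map w (\<lambda>x. if x = 0 then 0 else k + x)" by (auto simp: mono_word_map_def)
  then have "pack (map (\<lambda>x. if x = 0 then 0 else k + x) w) = pack w" by (rule pack_map)
  moreover have "map (\<lambda>x. if x = 0 then 0 else k + x) w = map ((+) k) w"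
    using \<open>0 \<notin> set w\<close> by (auto intro!: map_cong)
  ultimately show ?thesis by simp
qed

lemma forest_word_Cons_leading:
  assumes "red_packed_forest (t # ts)"
  shows "forest_word (t # ts) \<in> full_prod (forest_word [t]) (forest_word ts)"
    and "x \<in> full_prod (forest_word [t]) (forest_word ts) \<Longrightarrow> x \<noteq> forest_word (t # ts) \<Longrightarrow>
      card (inversions x) < card (inversions (forest_word (t # ts)))"
proof -
  let ?a = "map ((+) (wmax (forest_word ts))) (forest_word [t])"
  have pk: "packed (forest_word [t])" "packed (forest_word ts)" "packed (forest_word (t # ts))"
    using assms by (auto intro: packed_forest_word)
  have e: "forest_word (t # ts) = ?a @ forest_word ts"
    using forest_word_append[of "[t]" ts] assms by simp
  have lt: "y < x" if x: "x \<in> set ?a" and y: "y \<in> set (forest_word ts)" for x y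
  proof -
    obtain z where z: "z \<in> set (forest_word [t])" "x = wmax (forest_word ts) + z" using x by auto
    have "z \<noteq> 0" using packed_pos[OF pk(1)] z(1) by metis
    then show ?thesis using z(2) le_wmax[OF y] by linarith
  qed
  have p: "pack ?a = forest_word [t]" "pack (forest_word ts) = forest_word ts"
    using pack_map_add[OF packed_pos[OF pk(1)]] pk by (auto simp: pack_packed)
  note L = full_prod_leading[OF _ lt p, folded e, OF pk(3)]
  show "forest_word (t # ts) \<in> full_prod (forest_word [t]) (forest_word ts)"
    using L(1) .
  show "x \<in> full_prod (forest_word [t]) (forest_word ts) \<Longrightarrow> x \<noteq> forest_word (t # ts) \<Longrightarrow>
      card (inversions x) < card (inversions (forest_word (t # ts)))"
    using L(2) .
qed

text \<open>The word consists of the letters of \<open>ls\<close>, those of \<open>rs\<close> with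
  the new maximum woven in, and those of \<open>ts\<close>. Except for that maximum, each block lies
  above the following ones, as \<open>mid_prod_leading\<close> requires.\<close>

lemma forest_word_Node_leading:
  assumes "red_packed_forest (Node I ls rs # ts)"
  defines "M \<equiv> mid_prod (forest_word ls) (forest_word [Node I [] rs]) (forest_word ts)"
  shows "forest_word (Node I ls rs # ts) \<in> M"
    and "x \<in> M \<Longrightarrow> x \<noteq> forest_word (Node I ls rs # ts) \<Longrightarrow>
      card (inversions x) < card (inversions (forest_word (Node I ls rs # ts)))"
proof -
  have N: "red_packed (Node I ls rs)" "red_packed (Node I [] rs)"
    and F: "red_packed_forest ls" "red_packed_forest rs" "red_packed_forest ts"
    using assms(1) red_packed_NodeD[of I ls rs] by simp_all
  \<comment> \<open>\<open>?k\<close> lifts \<open>rs\<close> above \<open>ts\<close>,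
    \<open>?l\<close> lifts \<open>ls\<close> above both, and \<open>?m\<close> is the new
    maximum.\<close>
  let ?k = "wmax (forest_word ts)" and ?l = "wmax (forest_word (rs @ ts))"
    and ?m = "Suc (wmax (forest_word (ls @ rs @ ts)))" and ?b = "position_bits I (card I + forest_weight rs)"
  let ?a = "map ((+) ?l) (forest_word ls)" and ?r = "map ((+) ?k) (forest_word rs)"
    and ?w = "forest_word (ls @ rs @ ts)"
  let ?B = "weave ?m ?b ?r"
  have w2: "forest_word (rs @ ts) = ?r @ forest_word ts"
    and w1: "?w = ?a @ ?r @ forest_word ts"
    using F forest_word_append[of rs ts] forest_word_append[of ls "rs @ ts"] by auto
  have "forest_word (Node I ls rs # ts)
    = weave ?m (replicate (length ?a) False @ ?b @ replicate (length (forest_word ts)) False)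
        (?a @ ?r @ forest_word ts)"
    using root_bits(1)[OF N(1), of ts] w1 by (simp add: forest_word.simps(2) Let_def)
  also have "\<dots> = ?a @ ?B @ forest_word ts"
    using root_bits(3)[OF N(1)] weave_replicate_False[of ?m ?a]
      weave_replicate_False[of ?m "forest_word ts"]
    by (simp add: weave_append)
  finally have e: "forest_word (Node I ls rs # ts) = ?a @ ?B @ forest_word ts" .
  have pk: "packed (forest_word ls)" "packed (forest_word rs)" "packed (forest_word ts)"
    "packed (forest_word (Node I ls rs # ts))" "packed (forest_word [Node I [] rs])"
    "packed (forest_word (rs @ ts))"
    using assms N F by (auto intro!: packed_forest_word)
  note pos = packed_pos[OF pk(1)] packed_pos[OF pk(2)] packed_pos[OF pk(3)]
  have setB: "set ?B = insert ?m (set ?r)"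
    using root_bits(3,5)[OF N(1)] by (simp add: set_weave)
  have wB: "wmax ?B = ?m" using wmax_insert[OF setB] w1 by simp
  have ltw: "x < ?m" if "x \<in> set ?w" for x using le_wmax[OF that] by simp
  have aw: "set ?a \<subseteq> set ?w" "set ?r \<subseteq> set ?w" "set (forest_word ts) \<subseteq> set ?w"
    unfolding w1 by auto
  have gta: "?l < x" if "x \<in> set ?a" for x
    using that pos(1) by (auto intro!: gr0I)
  have gtr: "?k < x" if "x \<in> set ?r" for x
    using that pos(2) by (auto intro!: gr0I)
  \<comment> \<open>\<open>g\<close> turns the word of \<open>Node I [] rs\<close> into the middle
    block. The top letter goes to \<open>?m\<close>, above the letters of \<open>ls\<close> as well,
    so in general \<open>g\<close> is not a shift.\<close>
  define g where
    "g x = (if x = 0 then 0 else if x = Suc (wmax (forest_word rs)) then ?m else ?k + x)" for x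
  have "pack ?B = forest_word [Node I [] rs]"
  proof -
    have fw: "forest_word [Node I [] rs] = weave (Suc (wmax (forest_word rs))) ?b (forest_word rs)"
      by (simp add: forest_word.simps(2) Let_def)
    have rle: "x \<le> wmax (forest_word rs)" "x \<noteq> 0" "?k + x < ?m" if "x \<in> set (forest_word rs)" for x
    proof -
      show "x \<le> wmax (forest_word rs)" using that by (rule le_wmax)
      show "x \<noteq> 0" using that pos(2) by metis
      have "?k + x \<in> set ?w" using aw(2) that by auto
      then show "?k + x < ?m" by (rule ltw)
    qed
    have gr: "map g (forest_word rs) = ?r" using rle by (fastforce simp: g_def)
    have gm: "g (Suc (wmax (forest_word rs))) = ?m" by (simp add: g_def)
    have "weave (g (Suc (wmax (forest_word rs)))) ?b (map g (forest_word rs))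
        = map g (weave (Suc (wmax (forest_word rs))) ?b (forest_word rs))"
      using root_bits(3)[OF N(1)] by (intro weave_map) simp
    then have "map g (forest_word [Node I [] rs]) = ?B" by (simp only: fw gr gm)
    moreover have "mono_word_map (forest_word [Node I [] rs]) g"
    proof -
      have "g x < g y" if "x < y" "x \<in> insert 0 (set (forest_word [Node I [] rs]))"
        "y \<in> insert 0 (set (forest_word [Node I [] rs]))" for x y
        using that rle[of x] rle[of y] set_forest_word_Cons[OF N(2), of "[]"] by (auto simp: g_def)
      then show ?thesis using packed_pos[OF pk(5)] by (auto simp: mono_word_map_def g_def)
    qed
    ultimately show ?thesis using pack_map pack_packed[OF pk(5)] by metis
  qed
  moreover have "pack ?a = forest_word ls" "pack (forest_word ts) = forest_word ts"
    using pack_map_add[OF pos(1)] pk by (auto simp: pack_packed)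
  moreover have "wmax ?a < wmax ?B" "wmax (forest_word ts) < wmax ?B"
    unfolding wB by (simp_all add: w1)
  moreover have "y < x" if "x \<in> set ?a" "y \<in> set ?B" "y \<noteq> wmax ?B" for x y
  proof -
    have "y \<in> set (forest_word (rs @ ts))" using that setB wB w2 by auto
    then show ?thesis using gta[OF that(1)] le_wmax by fastforce
  qed
  moreover have "y < x" if "x \<in> set ?a" "y \<in> set (forest_word ts)" for x y
  proof -
    have "y \<in> set (forest_word (rs @ ts))" using that w2 by auto
    then show ?thesis using gta[OF that(1)] le_wmax by fastforce
  qed
  moreover have "y < x" if "x \<in> set ?B" "y \<in> set (forest_word ts)" for x y
    using that setB gtr le_wmax[OF that(2)] ltw aw(3) by fastforce
  ultimately have *: "?a @ ?B @ forest_word ts \<in> M" "x \<in> M \<Longrightarrow> x \<noteq> ?a @ ?B @ forest_word ts \<Longrightarrow>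
      card (inversions x) < card (inversions (?a @ ?B @ forest_word ts))" for x
    unfolding M_def using pk(4)[unfolded e]
    by (blast intro: mid_prod_leading(1), blast intro: mid_prod_leading(2))
  show "forest_word (Node I ls rs # ts) \<in> M" using *(1) unfolding e .
  show "x \<in> M \<Longrightarrow> x \<noteq> forest_word (Node I ls rs # ts) \<Longrightarrow>
      card (inversions x) < card (inversions (forest_word (Node I ls rs # ts)))"
    using *(2) unfolding e .
qed

section \<open>Bijectivity\<close>

lemma forest_prefix_exists:
  obtains ls us where "ts = ls @ us" "forest_weight ls \<le> k"
    "us \<noteq> [] \<longrightarrow> k < forest_weight ls + weight (hd us)"
proof -
  have "\<exists>ls us. ts = ls @ us \<and> forest_weight ls \<le> k \<and> (us \<noteq> [] \<longrightarrow> k < forest_weight ls + weight (hd us))"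
  proof (induction ts arbitrary: k)
    case (Cons t ts)
    show ?case
    proof (cases "weight t \<le> k")
      case True
      from Cons[of "k - weight t"] obtain ls us where "ts = ls @ us" "forest_weight ls \<le> k - weight t"
        "us \<noteq> [] \<longrightarrow> k - weight t < forest_weight ls + weight (hd us)" by blast
      then show ?thesis using True by (intro exI[of _ "t # ls"] exI[of _ us]) auto
    next
      case False
      then show ?thesis by (intro exI[of _ "[]"] exI[of _ "t # ts"]) auto
    qed
  qed simp
  then show ?thesis using that by blast
qed

text \<open>Of two different prefixes, the longer contains the first tree after the shorter one, and
  that tree already pushes the weight beyond \<open>k\<close>.\<close>

lemma forest_prefix_unique:
  assumes "ls @ us = ls' @ us'" "forest_weight ls \<le> k" "forest_weight ls' \<le> k"
    "us \<noteq> [] \<Longrightarrow> k < forest_weight ls + weight (hd us)"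
    "us' \<noteq> [] \<Longrightarrow> k < forest_weight ls' + weight (hd us')"
  shows "ls = ls' \<and> us = us'"
proof -
  from assms(1) obtain xs where "ls = ls' @ xs \<and> xs @ us = us' \<or> ls @ xs = ls' \<and> us = xs @ us'"
    by (auto simp: append_eq_append_conv2)
  then show ?thesis using assms by (cases xs) auto
qed

lemma forest_weight_rev [simp]: "forest_weight (rev ts) = forest_weight ts"
  by (induction ts) auto

lemma forest_suffix_exists:
  obtains rs ts where "us = rs @ ts" "forest_weight ts \<le> k"
    "rs \<noteq> [] \<longrightarrow> k < forest_weight ts + weight (last rs)"
proof -
  obtain xs ys where "rev us = xs @ ys" "forest_weight xs \<le> k"
    "ys \<noteq> [] \<longrightarrow> k < forest_weight xs + weight (hd ys)" using forest_prefix_exists .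
  moreover from this(1) have "us = rev ys @ rev xs" by (metis rev_append rev_rev_ident)
  ultimately show ?thesis by (intro that[of "rev ys" "rev xs"]) (auto simp: last_rev)
qed

lemma forest_suffix_unique:
  assumes "rs @ ts = rs' @ ts'" "forest_weight ts \<le> k" "forest_weight ts' \<le> k"
    "rs \<noteq> [] \<Longrightarrow> k < forest_weight ts + weight (last rs)"
    "rs' \<noteq> [] \<Longrightarrow> k < forest_weight ts' + weight (last rs')"
  shows "rs = rs' \<and> ts = ts'"
  using forest_prefix_unique[of "rev ts" "rev rs" "rev ts'" "rev rs'" k] assms
  by (auto simp: hd_rev simp flip: rev_append)

text \<open>A set is contained in the interval spanned by its extremes; equal cardinality forces
  equality. This identifies the label when the right forest is empty.\<close>

lemma card_le_Max_Min:
  fixes J :: "nat set"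
  assumes "finite J" "J \<noteq> {}"
  shows "card J + Min J \<le> Max J + 1"
    and "card J + Min J = Max J + 1 \<Longrightarrow> J = {Min J..Max J}"
proof -
  have sub: "J \<subseteq> {Min J..Max J}" using assms by auto
  then have "card J \<le> card {Min J..Max J}" by (intro card_mono) auto
  moreover have "Min J \<le> Max J" using assms by simp
  ultimately show "card J + Min J \<le> Max J + 1" by simp
  assume "card J + Min J = Max J + 1"
  then have "card {Min J..Max J} = card J" by simp
  with sub show "J = {Min J..Max J}" by (simp add: card_subset_eq)
qed

lemma Min_Max_shift:
  fixes I :: "nat set"
  assumes "finite I" "I \<noteq> {}"
  shows "Min ((+) a ` I) = a + Min I" "Max ((+) a ` I) = a + Max I"
proof -
  show "Min ((+) a ` I) = a + Min I" using assms
    by (intro Min_eqI) auto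
  show "Max ((+) a ` I) = a + Max I" using assms
    by (intro Max_eqI) auto
qed

text \<open>The three parts \<open>ls\<close>, \<open>rs\<close>, \<open>ts\<close> are recovered from their concatenation and
  the set \<open>J\<close> of positions of the maximal letter: \<open>ls\<close> is the longest prefix ending before the
  first maximum, \<open>ts\<close> the longest suffix of the rest starting after the last one.\<close>

lemma root_split_conditions:
  assumes "red_packed_forest (Node I ls rs # ts)"
  defines "J \<equiv> (+) (forest_weight ls) ` I" and "n \<equiv> card I + forest_weight (ls @ rs @ ts)"
  shows "forest_weight ls \<le> Min J - 1"
    and "rs @ ts \<noteq> [] \<Longrightarrow> Min J - 1 < forest_weight ls + weight (hd (rs @ ts))"
    and "forest_weight ts \<le> n - Max J"
    and "rs \<noteq> [] \<Longrightarrow> n - Max J < forest_weight ts + weight (last rs)"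
proof -
  have N: "red_packed (Node I ls rs)" and ts: "red_packed_forest ts" using assms by auto
  have I: "finite I" "I \<noteq> {}" "I \<subseteq> {1..card I + forest_weight rs}"
    using N red_packed_label_subset[OF N] by (auto simp: red_packed_Node)
  have c: "rs = [] \<and> I = {1..card I} \<or>
      rs \<noteq> [] \<and> Min I \<le> weight (hd rs) \<and> card I + forest_weight rs + 1 \<le> Max I + weight (last rs)"
    using N unfolding red_packed_Node by blast
  have J: "Min J = forest_weight ls + Min I" "Max J = forest_weight ls + Max I"
    unfolding J_def using Min_Max_shift I by auto
  have m: "Min I \<in> {1..card I + forest_weight rs}" "Max I \<in> {1..card I + forest_weight rs}"
    using I(3) Min_in[OF I(1,2)] Max_in[OF I(1,2)] by blast+
  show "forest_weight ls \<le> Min J - 1" using J m by auto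
  show "forest_weight ts \<le> n - Max J" using J m by (auto simp: n_def)
  show "n - Max J < forest_weight ts + weight (last rs)" if "rs \<noteq> []" using c that J m by (auto simp: n_def)
  show "Min J - 1 < forest_weight ls + weight (hd (rs @ ts))" if ne: "rs @ ts \<noteq> []"
  proof (cases "rs = []")
    case True
    \<comment> \<open>With an empty right forest, the next tree is the first one of
      \<open>ts\<close>. The label starts at 1, so positive weight of that tree suffices.\<close>
    have "Min I = 1"
    proof (rule Min_eqI)
      show "1 \<in> I" using True c I(1,2) by (metis atLeastAtMost_iff card_gt_0_iff le_refl less_one not_le)
      show "1 \<le> y" if "y \<in> I" for y using that I(3) by auto
    qed (rule I(1))
    moreover have "0 < weight (hd ts)" using True ne ts by (cases ts) (auto simp: red_packed_weight_pos)
    ultimately show ?thesis using J True by simp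
  next
    case False
    then show ?thesis using c J m by auto
  qed
qed

text \<open>\<open>Min J - 1\<close> letters precede the first maximum and \<open>?n - Max J\<close>
  follow the last. Cutting greedily at these weights yields the inequalities demanded of a root with
  nonempty right forest.\<close>

lemma root_split_exists:
  assumes F: "red_packed_forest F" and J: "J \<subseteq> {1..card J + forest_weight F}" "J \<noteq> {}"
  obtains I ls rs ts where "F = ls @ rs @ ts" "J = (+) (forest_weight ls) ` I"
    "red_packed_forest (Node I ls rs # ts)"
proof -
  have fJ: "finite J" using J finite_subset by blast
  let ?n = "card J + forest_weight F"
  have mJ: "Min J \<in> {1..?n}" "Max J \<in> {1..?n}" using J(1) Min_in[OF fJ J(2)] Max_in[OF fJ J(2)] by blast+
  note cJ = card_le_Max_Min[OF fJ J(2)]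
  obtain ls us where ls: "F = ls @ us" "forest_weight ls \<le> Min J - 1"
    "us \<noteq> [] \<longrightarrow> Min J - 1 < forest_weight ls + weight (hd us)" using forest_prefix_exists .
  obtain rs ts where rs: "us = rs @ ts" "forest_weight ts \<le> ?n - Max J"
    "rs \<noteq> [] \<longrightarrow> ?n - Max J < forest_weight ts + weight (last rs)" using forest_suffix_exists .
  define I where "I = (\<lambda>j. j - forest_weight ls) ` J"
  have ge: "forest_weight ls < j" if "j \<in> J" for j
    using ls(2) mJ(1) Min_le[OF fJ that] by auto
  have JI: "J = (+) (forest_weight ls) ` I"
  proof -
    have "(+) (forest_weight ls) ` I = (\<lambda>j. forest_weight ls + (j - forest_weight ls)) ` J"
      by (simp add: I_def image_image)
    also have "\<dots> = (\<lambda>j. j) ` J" by (rule image_cong) (use ge in force)+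
    finally show ?thesis by simp
  qed
  have I: "finite I" "I \<noteq> {}" "0 \<notin> I" using fJ J(2) by (auto simp: I_def dest!: ge)
  have cI: "card I = card J" unfolding JI by (simp add: card_image)
  have MM: "Min J = forest_weight ls + Min I" "Max J = forest_weight ls + Max I"
    using Min_Max_shift[OF I(1,2)] by (simp_all only: JI)
  have cond: "rs = [] \<and> I = {1..card I} \<or>
      rs \<noteq> [] \<and> Min I \<le> weight (hd rs) \<and> Max I \<le> card I + forest_weight rs \<and>
      card I + forest_weight rs + 1 \<le> Max I + weight (last rs)"
  proof (cases "rs = []")
    case True
    \<comment> \<open>The two weight bounds give \<open>1 \<le> Min I\<close> and
      \<open>Max I \<le> card I\<close>. This is the extreme case of \<open>card_le_Max_Min\<close>,
      so the label is an interval starting at 1.\<close>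
    then have "card I + Min I \<ge> Max I + 1 \<and> Min I = 1"
      using ls rs mJ cJ(1) MM cI by auto
    then have "I = {Min I..Max I}" "Min I = 1" "Max I = card I"
      using card_le_Max_Min[OF I(1,2)] by auto
    then show ?thesis using True by simp
  next
    case False
    have hd: "hd us = hd rs" using False rs by simp
    have "Min I \<le> weight (hd rs)" using ls(3) hd False rs(1) MM mJ by auto
    moreover have "Max I \<le> card I + forest_weight rs" using rs(1,2) ls(1) MM mJ cI by auto
    moreover have "card I + forest_weight rs + 1 \<le> Max I + weight (last rs)"
      using rs(3) False rs(1) ls(1) MM mJ cI by auto
    ultimately show ?thesis using False by simp
  qed
  have "red_packed_forest (Node I ls rs # ts)"
    using F ls(1) rs(1) I cond unfolding red_packed_forest_simps red_packed_Node by simp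
  then show ?thesis using that JI ls(1) rs(1) by simp
qed

text \<open>Induction on the length: erase the maximal letters, take a forest of the remaining word
  and restore a root from the erased positions.\<close>

lemma forest_word_surj:
  assumes "packed w"
  obtains ts where "red_packed_forest ts" "forest_word ts = w"
proof -
  have "\<exists>ts. red_packed_forest ts \<and> forest_word ts = w"
    using assms
  proof (induction "length w" arbitrary: w rule: less_induct)
    case less
    show ?case
    proof (cases "w = []")
      case True
      then show ?thesis by (intro exI[of _ "[]"]) simp
    next
      case False
      define m where "m = wmax w"
      have w: "set w = {1..m}" using less(2) by (simp add: packed_def m_def)
      then have m: "m \<in> set w" using False wmax_in[of w] by (auto simp: m_def)
      let ?v = "filter (\<lambda>x. x \<noteq> m) w"
      have v: "set ?v = {1..m - 1}" using w by auto
      have pv: "packed ?v" using v by (rule packedI)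
      \<comment> \<open>Erasing one letter value lowers the number of distinct letters, hence the
        maximum, by exactly one.\<close>
      have wv: "Suc (wmax ?v) = m"
      proof -
        have "set ?v = {1..wmax ?v}" using pv by (simp add: packed_def)
        then have "card {1..m - 1} = card {1..wmax ?v}" using v by metis
        moreover have "1 \<le> m" using m w by simp
        ultimately show ?thesis by simp
      qed
      have lv: "length ?v < length w" using m by (intro length_filter_less[of m]) auto
      from less(1)[OF lv pv] obtain F where F: "red_packed_forest F" "forest_word F = ?v" by blast
      define J where "J = {j \<in> {1..length w}. w ! (j - 1) = m}"
      have J1: "J \<subseteq> {1..length w}" by (auto simp: J_def)
      have bits: "position_bits J (length w) = map (\<lambda>x. x = m) w"
        by (rule nth_equalityI) (auto simp: position_bits_nth J_def)
      have fF: "forest_weight F = length ?v" using F(2) by (metis length_forest_word)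
      have "length ?v = length w - card J"
        using position_bits_False[OF J1] unfolding bits by (simp add: filter_map comp_def)
      moreover have "card J \<le> length w" using card_mono[OF _ J1] by simp
      ultimately have cJ: "card J + forest_weight F = length w" using fF by simp
      have "J \<noteq> {}"
      proof -
        obtain i where "i < length w" "w ! i = m" using m by (auto simp: in_set_conv_nth)
        then have "Suc i \<in> J" by (simp add: J_def)
        then show ?thesis by blast
      qed
      with J1 cJ obtain I ls rs ts where S: "F = ls @ rs @ ts" "J = (+) (forest_weight ls) ` I"
        "red_packed_forest (Node I ls rs # ts)"
        using root_split_exists[OF F(1), of J] by metis
      have "card I = card J" unfolding S(2) by (simp add: card_image)
      then have "forest_word (Node I ls rs # ts) = weave m (map (\<lambda>x. x = m) w) ?v"
        using F(2) S(1,2) fF cJ wv bits by (simp add: forest_word.simps(2) Let_def)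
      also have "\<dots> = w" by (rule weave_unweave)
      finally show ?thesis using S(3) by blast
    qed
  qed
  then show ?thesis using that by blast
qed

text \<open>Equal words have the same maximum. Erasing it leaves equal words, so by induction equal
  concatenations \<open>ls @ rs @ ts\<close>; its positions then determine the two cuts and the
  label.\<close>

lemma forest_word_inj:
  "red_packed_forest ts \<Longrightarrow> red_packed_forest us \<Longrightarrow> forest_word ts = forest_word us \<Longrightarrow> ts = us"
proof (induction ts arbitrary: us rule: forest_word.induct)
  case 1
  have "forest_weight us = 0" using 1(3) by (metis length_forest_word list.size(3) forest_word.simps(1))
  then show ?case using 1(2) by (cases us) (auto dest: red_packed_weight_pos)
next
  case (2 I ls rs ts)
  have N: "red_packed (Node I ls rs)" using 2(2) by simp
  have "forest_weight us \<noteq> 0" using 2(4) red_packed_weight_pos[OF N]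
    by (metis length_forest_word forest_weight_simps(2) add_is_0 less_irrefl)
  then obtain I' ls' rs' ts' where us: "us = Node I' ls' rs' # ts'"
    by (metis biplane_tree.exhaust forest_weight_simps(1) neq_Nil_conv)
  have N': "red_packed (Node I' ls' rs')" using 2(3) us by simp
  let ?w = "forest_word (ls @ rs @ ts)" and ?w' = "forest_word (ls' @ rs' @ ts')"
  let ?J = "(+) (forest_weight ls) ` I" and ?J' = "(+) (forest_weight ls') ` I'"
  let ?n = "card I + forest_weight (ls @ rs @ ts)" and ?n' = "card I' + forest_weight (ls' @ rs' @ ts')"
  let ?m = "Suc (wmax ?w)"
  have m: "Suc (wmax ?w') = ?m"
    using wmax_forest_word_Cons[OF N, of ts] wmax_forest_word_Cons[OF N', of ts'] 2(4) us by simp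
  have e: "weave ?m (position_bits ?J ?n) ?w = weave ?m (position_bits ?J' ?n') ?w'"
    using 2(4) us m by (simp add: forest_word.simps(2) Let_def)
  have nin: "?m \<notin> set ?w" "?m \<notin> set ?w'"
    using le_wmax[of ?m ?w] le_wmax[of ?m ?w'] m by auto
  have lw: "length (filter Not (position_bits ?J ?n)) = length ?w"
    "length (filter Not (position_bits ?J' ?n')) = length ?w'"
    using root_bits(2)[OF N, of ts] root_bits(2)[OF N', of ts'] by simp_all
  have "?w = ?w'" using weave_rest[OF lw(1) nin(1)] weave_rest[OF lw(2) nin(2)] e by simp
  moreover have "red_packed_forest (ls @ rs @ ts)" "red_packed_forest (ls' @ rs' @ ts')"
    using 2(2,3) us by (simp_all add: red_packed_Node)
  ultimately have cat: "ls @ rs @ ts = ls' @ rs' @ ts'" using 2(1) by blast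
  have bits: "position_bits ?J ?n = position_bits ?J' ?n'"
    using weave_positions[OF lw(1) nin(1)] weave_positions[OF lw(2) nin(2)] e by simp
  then have n: "?n = ?n'" by (metis length_position_bits)
  have sub: "(+) a ` K \<subseteq> {1..card K + (a + (b + c))}" if "K \<subseteq> {1..card K + b}" for a b c :: nat and K
    using that by fastforce
  have "?J \<subseteq> {1..?n}" "?J' \<subseteq> {1..?n'}"
    using sub[OF red_packed_label_subset[OF N]] sub[OF red_packed_label_subset[OF N']] by simp_all
  then have JJ: "?J = ?J'" using bits n by (metis position_bits_inj)
  note S = root_split_conditions[OF 2(2)] and S' = root_split_conditions[OF 2(3)[unfolded us]]
  have "ls = ls' \<and> rs @ ts = rs' @ ts'"
    using forest_prefix_unique[OF cat S(1) _ S(2)] S'(1,2) JJ by simp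
  moreover from this have "rs = rs' \<and> ts = ts'"
    using forest_suffix_unique[of rs ts rs' ts', OF _ S(3) _ S(4)] S'(3,4) JJ n by simp
  moreover have "I = I'" using JJ calculation by (simp add: inj_image_eq_iff)
  ultimately show ?case using us by simp
qed

lemma forest_word_bij:
  "bij_betw forest_word {ts. red_packed_forest ts \<and> forest_weight ts = n} (PW n)"
  unfolding bij_betw_def
proof
  show "inj_on forest_word {ts. red_packed_forest ts \<and> forest_weight ts = n}"
    using forest_word_inj by (auto intro!: inj_onI)
  show "forest_word ` {ts. red_packed_forest ts \<and> forest_weight ts = n} = PW n"
  proof (intro equalityI subsetI)
    fix w assume "w \<in> PW n"
    then have w: "packed w" "length w = n" by (auto simp: PW_def)
    obtain ts where "red_packed_forest ts" "forest_word ts = w" using forest_word_surj[OF w(1)] .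
    then show "w \<in> forest_word ` {ts. red_packed_forest ts \<and> forest_weight ts = n}" using w(2) by auto
  qed (auto simp: PW_def packed_forest_word)
qed

section \<open>Triangular linear systems and the coproducts\<close>

lemma span_single:
  "free_vs.span ((\<lambda>w. Poly_Mapping.single w (1::'k::field)) ` A) = {f. Poly_Mapping.keys f \<subseteq> A}"
proof (intro equalityI subsetI)
  fix f :: "'a \<Rightarrow>\<^sub>0 'k" assume "f \<in> free_vs.span ((\<lambda>w. Poly_Mapping.single w 1) ` A)"
  then show "f \<in> {f. Poly_Mapping.keys f \<subseteq> A}"
  proof (induction rule: free_vs.span_induct_alt)
    case (step c x y)
    have "Poly_Mapping.keys (fscale c x + y) \<subseteq> Poly_Mapping.keys x \<union> Poly_Mapping.keys y"
      by (auto simp: in_keys_iff lookup_add)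
    then show ?case using step by (auto split: if_splits)
  qed simp
next
  fix f :: "'a \<Rightarrow>\<^sub>0 'k" assume f: "f \<in> {f. Poly_Mapping.keys f \<subseteq> A}"
  have "f = (\<Sum>w\<in>Poly_Mapping.keys f. fscale (Poly_Mapping.lookup f w) (Poly_Mapping.single w 1))"
    by (rule poly_mapping_eqI)
      (auto simp: lookup_sum lookup_single when_def in_keys_iff if_distrib[of "(*) _"] cong: if_cong)
  also have "\<dots> \<in> free_vs.span ((\<lambda>w. Poly_Mapping.single w 1) ` A)"
    using f by (intro free_vs.span_sum free_vs.span_scale free_vs.span_base) auto
  finally show "f \<in> free_vs.span ((\<lambda>w. Poly_Mapping.single w 1) ` A)" .
qed

lemma single_one_eq_iff: "Poly_Mapping.single x (1::'k::field) = Poly_Mapping.single y 1 \<longleftrightarrow> x = y"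
  by (metis lookup_single_eq lookup_single_not_eq zero_neq_one)

lemma dim_keys_subset: "free_vs.dim {f :: 'a \<Rightarrow>\<^sub>0 'k::field. Poly_Mapping.keys f \<subseteq> A} = card A"
proof -
  let ?e = "\<lambda>w :: 'a. Poly_Mapping.single w (1::'k)"
  have "a \<notin> free_vs.span (?e ` A - {a})" if "a \<in> ?e ` A" for a
  proof -
    obtain x where x: "x \<in> A" "a = ?e x" using \<open>a \<in> ?e ` A\<close> by auto
    then have "?e ` A - {a} = ?e ` (A - {x})" by (auto simp: single_one_eq_iff)
    then show ?thesis using x by (simp add: span_single)
  qed
  then have "free_vs.independent (?e ` A)" by (auto simp: free_vs.dependent_def)
  then have "free_vs.dim (?e ` A) = card (?e ` A)" by (rule free_vs.dim_eq_card_independent)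
  also have "\<dots> = card A" by (rule card_image) (auto simp: inj_on_def single_one_eq_iff)
  finally show ?thesis unfolding span_single[symmetric] by simp
qed

lemma WQSym_dual_eq: "WQSym_dual n = {f. Poly_Mapping.keys f \<subseteq> PW n}"
  unfolding WQSym_dual_def RW_def by (rule span_single)

lemma dim_injective_linear_image:
  fixes T :: "('a \<Rightarrow>\<^sub>0 'k::field) \<Rightarrow> ('b \<Rightarrow>\<^sub>0 'k)"
  assumes T: "Vector_Spaces.linear fscale fscale T" and V: "free_vs.subspace V" and inj: "inj_on T V"
  shows "free_vs.dim (T ` V) = free_vs.dim V"
proof -
  interpret T: Vector_Spaces.linear fscale fscale T by (rule T)
  obtain B where B: "B \<subseteq> V" "free_vs.independent B" "V \<subseteq> free_vs.span B" "card B = free_vs.dim V"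
    using free_vs.basis_exists[of V] by blast
  have sB: "free_vs.span B = V" using B(1,3) V by (metis free_vs.span_minimal subset_antisym)
  have "free_vs.independent (T ` B)"
    using T.independent_injective_image[OF B(2)] inj sB by simp
  then have "free_vs.dim (T ` B) = card (T ` B)" by (rule free_vs.dim_eq_card_independent)
  moreover have "free_vs.span (T ` B) = T ` V" using T.span_image sB by simp
  moreover have "card (T ` B) = card B" using inj_on_subset[OF inj B(1)] by (rule card_image)
  ultimately show ?thesis using B(4) by (metis free_vs.dim_span)
qed

lemma subspace_sum_equations:
  "free_vs.subspace {f :: 'a \<Rightarrow>\<^sub>0 'k::field. Poly_Mapping.keys f \<subseteq> W \<and>
     (\<forall>i\<in>X. sum (Poly_Mapping.lookup f) (S i) = 0)}"
proof (rule free_vs.subspaceI)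
  fix f g :: "'a \<Rightarrow>\<^sub>0 'k"
  assume f: "f \<in> {f. Poly_Mapping.keys f \<subseteq> W \<and> (\<forall>i\<in>X. sum (Poly_Mapping.lookup f) (S i) = 0)}"
    and g: "g \<in> {f. Poly_Mapping.keys f \<subseteq> W \<and> (\<forall>i\<in>X. sum (Poly_Mapping.lookup f) (S i) = 0)}"
  show "f + g \<in> {f. Poly_Mapping.keys f \<subseteq> W \<and> (\<forall>i\<in>X. sum (Poly_Mapping.lookup f) (S i) = 0)}"
    using f g Poly_Mapping.keys_add[of f g] by (auto simp: lookup_add sum.distrib)
next
  fix f :: "'a \<Rightarrow>\<^sub>0 'k" and c :: 'k
  assume f: "f \<in> {f. Poly_Mapping.keys f \<subseteq> W \<and> (\<forall>i\<in>X. sum (Poly_Mapping.lookup f) (S i) = 0)}"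
  have "Poly_Mapping.keys (fscale c f) \<subseteq> Poly_Mapping.keys f" by (auto simp: in_keys_iff)
  then show "fscale c f \<in> {f. Poly_Mapping.keys f \<subseteq> W \<and> (\<forall>i\<in>X. sum (Poly_Mapping.lookup f) (S i) = 0)}"
    using f by (auto simp: sum_distrib_left[symmetric])
qed simp

text \<open>\<open>g\<close> prescribes the free coordinates. Each pivot coordinate is computed from
  coordinates of smaller rank, so a solution is built rank by rank.\<close>

lemma triangular_system_solution:
  fixes g :: "'a \<Rightarrow> 'k::field" and rk :: "'a \<Rightarrow> nat"
  assumes "\<And>r x. r \<in> R \<Longrightarrow> x \<in> S r - {r} \<Longrightarrow> rk x < rk r"
  shows "\<exists>h. \<forall>w. rk w < k \<longrightarrow> h w = (if w \<in> R then - (\<Sum>x \<in> S w - {w}. h x) else g w)"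
proof (induction k)
  case (Suc k)
  then obtain h where h: "\<And>w. rk w < k \<Longrightarrow> h w = (if w \<in> R then - (\<Sum>x \<in> S w - {w}. h x) else g w)"
    by blast
  \<comment> \<open>One more round of substitution: \<open>h'\<close> agrees with \<open>h\<close>
    below rank \<open>k\<close> and is correct at rank \<open>k\<close>.\<close>
  define h' where "h' w = (if w \<in> R then - (\<Sum>x \<in> S w - {w}. h x) else g w)" for w
  have h': "h' w = h w" if "rk w < k" for w using h[OF that] by (simp add: h'_def)
  have "h' w = (if w \<in> R then - (\<Sum>x \<in> S w - {w}. h' x) else g w)" if "rk w < Suc k" for w
  proof -
    have "(\<Sum>x \<in> S w - {w}. h' x) = (\<Sum>x \<in> S w - {w}. h x)" if "w \<in> R"
      using assms[OF \<open>w \<in> R\<close>] \<open>rk w < Suc k\<close> by (intro sum.cong refl h') fastforce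
    then show ?thesis by (simp add: h'_def)
  qed
  then show ?case by blast
qed simp

text \<open>Forgetting the pivot coordinates is injective on the solution space, since these are
  determined by induction on the rank, and it is onto the functions supported on
  \<open>W - R\<close>.\<close>

lemma dim_triangular_system:
  fixes rk :: "'a \<Rightarrow> nat"
  assumes W: "finite W" and R: "R \<subseteq> W"
    and S: "\<And>r. r \<in> R \<Longrightarrow> r \<in> S r" "\<And>r. r \<in> R \<Longrightarrow> S r \<subseteq> W"
      "\<And>r x. r \<in> R \<Longrightarrow> x \<in> S r - {r} \<Longrightarrow> rk x < rk r"
  shows "free_vs.dim {f :: 'a \<Rightarrow>\<^sub>0 'k::field. Poly_Mapping.keys f \<subseteq> W \<and>
     (\<forall>r\<in>R. sum (Poly_Mapping.lookup f) (S r) = 0)} = card (W - R)" (is "free_vs.dim ?V = _")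
proof -
  have eq: "sum f (S r) = 0 \<longleftrightarrow> f r = - (\<Sum>x \<in> S r - {r}. f x)" if "r \<in> R" for f :: "'a \<Rightarrow> 'k" and r
  proof -
    have "finite (S r)" using S(2)[OF that] W finite_subset by blast
    then show ?thesis using S(1)[OF that] by (simp add: sum.remove[of "S r" r] eq_neg_iff_add_eq_0)
  qed
  define T :: "('a \<Rightarrow>\<^sub>0 'k) \<Rightarrow> ('a \<Rightarrow>\<^sub>0 'k)"
    where "T = lin_ext (\<lambda>w. if w \<in> R then 0 else Poly_Mapping.single w 1)"
  have T: "Poly_Mapping.lookup (T f) w = (if w \<in> R then 0 else Poly_Mapping.lookup f w)" for f w
  proof -
    have "Poly_Mapping.lookup (T f) w = (\<Sum>u\<in>Poly_Mapping.keys f.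
        if u = w then (if w \<in> R then 0 else Poly_Mapping.lookup f w) else 0)"
      unfolding T_def lin_ext_def lookup_sum
      by (rule sum.cong) (auto simp: lookup_single when_def)
    then show ?thesis by (auto simp: in_keys_iff)
  qed
  have "inj_on T ?V"
  proof (rule inj_onI)
    fix f g assume f: "f \<in> ?V" and g: "g \<in> ?V" and e: "T f = T g"
    have "Poly_Mapping.lookup f w = Poly_Mapping.lookup g w" for w
    proof (induction "rk w" arbitrary: w rule: less_induct)
      case less
      show ?case
      proof (cases "w \<in> R")
        case True
        have "(\<Sum>x \<in> S w - {w}. Poly_Mapping.lookup f x) = (\<Sum>x \<in> S w - {w}. Poly_Mapping.lookup g x)"
          using less S(3)[OF True] by (intro sum.cong) auto
        moreover have "sum (Poly_Mapping.lookup f) (S w) = 0" "sum (Poly_Mapping.lookup g) (S w) = 0"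
          using f g True by auto
        ultimately show ?thesis unfolding eq[OF True] by simp
      next
        case False
        then show ?thesis using T[of f w] T[of g w] e by simp
      qed
    qed
    then show "f = g" by (rule poly_mapping_eqI)
  qed
  moreover have "T ` ?V = {f. Poly_Mapping.keys f \<subseteq> W - R}"
  proof (intro equalityI subsetI)
    fix f assume "f \<in> T ` ?V"
    then show "f \<in> {f. Poly_Mapping.keys f \<subseteq> W - R}" by (auto simp: in_keys_iff T split: if_splits)
  next
    fix g :: "'a \<Rightarrow>\<^sub>0 'k" assume g: "g \<in> {f. Poly_Mapping.keys f \<subseteq> W - R}"
    \<comment> \<open>A bound above all ranks in \<open>W\<close>, so the partial solution is
      correct on all of \<open>W\<close>.\<close>
    let ?k = "Suc (Max (rk ` W))"
    obtain h0 where h0: "\<And>w. rk w < ?k \<Longrightarrow>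
        h0 w = (if w \<in> R then - (\<Sum>x \<in> S w - {w}. h0 x) else Poly_Mapping.lookup g w)"
      using triangular_system_solution[where g = "Poly_Mapping.lookup g" and rk = rk and k = ?k, OF S(3)] by blast
    \<comment> \<open>Cutting off outside \<open>W\<close> gives finite support and changes no
      equation, as each \<open>S r\<close> lies in \<open>W\<close>.\<close>
    define h where "h w = (if w \<in> W then h0 w else 0)" for w
    have "{w. h w \<noteq> 0} \<subseteq> W" by (auto simp: h_def)
    then have lh: "Poly_Mapping.lookup (Abs_poly_mapping h) = h"
      using W finite_subset by (intro lookup_Abs_poly_mapping) blast
    have hw: "h w = (if w \<in> R then - (\<Sum>x \<in> S w - {w}. h x) else Poly_Mapping.lookup g w)" if "w \<in> W" for w
    proof -
      have "rk w < ?k" using that W by (simp add: less_Suc_eq_le)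
      moreover have "(\<Sum>x \<in> S w - {w}. h0 x) = (\<Sum>x \<in> S w - {w}. h x)" if "w \<in> R"
        using S(2)[OF that] by (intro sum.cong) (auto simp: h_def)
      ultimately show ?thesis using h0[of w] that by (simp add: h_def)
    qed
    have "Abs_poly_mapping h \<in> ?V"
    proof -
      have "Poly_Mapping.keys (Abs_poly_mapping h) \<subseteq> W" by (auto simp: in_keys_iff lh h_def split: if_splits)
      moreover have "sum h (S r) = 0" if "r \<in> R" for r
        using eq[OF that, of h] hw[of r] that R by auto
      ultimately show ?thesis by (simp add: lh)
    qed
    moreover have "T (Abs_poly_mapping h) = g"
    proof (rule poly_mapping_eqI)
      fix w
      have "w \<notin> W - R \<Longrightarrow> Poly_Mapping.lookup g w = 0" using g by (auto simp: in_keys_iff)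
      then show "Poly_Mapping.lookup (T (Abs_poly_mapping h)) w = Poly_Mapping.lookup g w"
        using hw[of w] by (auto simp: T lh h_def)
    qed
    ultimately show "g \<in> T ` ?V" by blast
  qed
  moreover have "Vector_Spaces.linear fscale fscale T" unfolding T_def by (rule linear_lin_ext)
  ultimately show ?thesis
    using dim_injective_linear_image[OF _ subspace_sum_equations, of T W R S] dim_keys_subset[where A = "W - R" and 'k = 'k]
    by simp
qed

lemma dim_triangular_system_indexed:
  fixes rk :: "'a \<Rightarrow> nat"
  assumes W: "finite W" and p: "inj_on p X" "p ` X \<subseteq> W"
    and S: "\<And>i. i \<in> X \<Longrightarrow> p i \<in> S i" "\<And>i. i \<in> X \<Longrightarrow> S i \<subseteq> W"
      "\<And>i x. i \<in> X \<Longrightarrow> x \<in> S i - {p i} \<Longrightarrow> rk x < rk (p i)"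
  shows "free_vs.dim {f :: 'a \<Rightarrow>\<^sub>0 'k::field. Poly_Mapping.keys f \<subseteq> W \<and>
     (\<forall>i\<in>X. sum (Poly_Mapping.lookup f) (S i) = 0)} = card (W - p ` X)"
proof -
  have q: "the_inv_into X p (p i) = i" if "i \<in> X" for i using p(1) that by (rule the_inv_into_f_f)
  have "free_vs.dim {f :: 'a \<Rightarrow>\<^sub>0 'k. Poly_Mapping.keys f \<subseteq> W \<and>
     (\<forall>r\<in>p ` X. sum (Poly_Mapping.lookup f) (S (the_inv_into X p r)) = 0)} = card (W - p ` X)"
  proof (rule dim_triangular_system[where rk = rk, OF W p(2)])
    fix r assume "r \<in> p ` X"
    then obtain i where i: "i \<in> X" "r = p i" by blast
    show "r \<in> S (the_inv_into X p r)" "S (the_inv_into X p r) \<subseteq> W" using i q S(1,2) by simp_all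
    show "rk x < rk r" if "x \<in> S (the_inv_into X p r) - {r}" for x using that i q S(3) by simp
  qed
  then show ?thesis by (simp add: q)
qed

text \<open>Duality term by term: the tensor of \<open>u\<close> and \<open>v\<close> arises from a
  cut of \<open>w\<close> exactly when \<open>w\<close> is a term of the corresponding
  half-product.\<close>

lemma pack_cut_iff:
  assumes "packed w"
  shows "i \<in> left_cuts w \<and> pack (take i w) = u \<and> pack (drop i w) = v \<longleftrightarrow>
      i = length u \<and> u \<noteq> [] \<and> v \<noteq> [] \<and> w \<in> prec_prod u v" (is ?L)
    and "i \<in> right_cuts w \<and> pack (take i w) = u \<and> pack (drop i w) = v \<longleftrightarrow>
      i = length u \<and> u \<noteq> [] \<and> v \<noteq> [] \<and> w \<in> succ_prod u v" (is ?R)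
proof -
  \<comment> \<open>Nonempty factors of a packed word contain their maxima, and disjointness makes
    these different. Hence locating the overall maximum means comparing the two.\<close>
  have loc: "wmax (p @ q) \<in> set p \<longleftrightarrow> wmax q < wmax p" "wmax (p @ q) \<notin> set p \<longleftrightarrow> wmax p < wmax q"
    if "p @ q = w" "set p \<inter> set q = {}" "p \<noteq> []" "q \<noteq> []" for p q
  proof -
    have "0 \<notin> set p" "0 \<notin> set q" using packed_pos[OF assms] that(1) by auto
    then have "wmax p \<in> set p" "wmax q \<in> set q" if "p \<noteq> []" "q \<noteq> []"
      using wmax_in[of p] wmax_in[of q] le_wmax[of "hd p" p] le_wmax[of "hd q" q] that
      by (auto simp: neq_Nil_conv)
    then have m: "wmax p \<in> set p" "wmax q \<in> set q" using that by auto
    then have "wmax p \<noteq> wmax q" "wmax q \<notin> set p" using that(2) by (metis disjoint_iff)+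
    then show "wmax (p @ q) \<in> set p \<longleftrightarrow> wmax q < wmax p" "wmax (p @ q) \<notin> set p \<longleftrightarrow> wmax p < wmax q"
      using m by (auto simp: max_def)
  qed
  have cut: "i \<in> {i. 1 \<le> i \<and> i < length w \<and> set (take i w) \<inter> set (drop i w) = {} \<and> Q i}
      \<and> pack (take i w) = u \<and> pack (drop i w) = v \<longleftrightarrow>
      i = length u \<and> u \<noteq> [] \<and> v \<noteq> [] \<and> w \<in> cut_prod c u v" (is "?A \<longleftrightarrow> ?B")
    if Q: "\<And>i. 1 \<le> i \<Longrightarrow> i < length w \<Longrightarrow> set (take i w) \<inter> set (drop i w) = {} \<Longrightarrow>
      Q i \<longleftrightarrow> c (wmax (take i w)) (wmax (drop i w))" for Q c
  proof
    assume A: ?A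
    then have i: "1 \<le> i" "i < length w" "set (take i w) \<inter> set (drop i w) = {}" "Q i"
      "pack (take i w) = u" "pack (drop i w) = v" by auto
    have l: "length u = i" "length v = length w - i" using i length_pack[of "take i w"] length_pack[of "drop i w"] by auto
    have "w \<in> cut_prod c u v" unfolding cut_prod_def using i Q[OF i(1-3)] assms
      by (intro CollectI exI[of _ "take i w"] exI[of _ "drop i w"]) simp
    then show ?B using l i by auto
  next
    assume B: ?B
    then obtain p q where pq: "w = p @ q" "set p \<inter> set q = {}" "pack p = u" "pack q = v" "c (wmax p) (wmax q)"
      by (auto simp: cut_prod_def)
    have l: "length p = length u" "length q = length v" using pq length_pack[of p] length_pack[of q] by auto
    then have td: "take i w = p" "drop i w = q" using B pq(1) by auto
    have "1 \<le> i" "i < length w" using B l pq(1) by (auto simp: Suc_le_eq)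
    then show ?A using Q[of i] pq(2-5) td by simp
  qed
  have ne: "take i w \<noteq> []" "drop i w \<noteq> []" if "1 \<le> i" "i < length w" for i using that by auto
  show ?L unfolding left_cuts_def
    by (rule cut) (use loc(1)[OF append_take_drop_id _ ne] in simp)
  show ?R unfolding right_cuts_def
    by (rule cut) (use loc(2)[OF append_take_drop_id _ ne] in simp)
qed

lemma lookup_lin_ext_cuts:
  fixes f :: "nat list \<Rightarrow>\<^sub>0 'k::field"
  assumes f: "Poly_Mapping.keys f \<subseteq> PW n"
    and cuts: "\<And>w. packed w \<Longrightarrow> finite (cuts w)" "\<And>w i. packed w \<Longrightarrow> i \<in> cuts w \<and> pack (take i w) = u \<and> pack (drop i w) = v \<longleftrightarrow>
      i = length u \<and> u \<noteq> [] \<and> v \<noteq> [] \<and> w \<in> cut_prod c u v"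
  shows "Poly_Mapping.lookup (lin_ext (\<lambda>w. \<Sum>i\<in>cuts w. RR (pack (take i w)) (pack (drop i w))) f) (u, v)
    = (if u \<noteq> [] \<and> v \<noteq> [] \<and> length u + length v = n then sum (Poly_Mapping.lookup f) (cut_prod c u v) else 0)"
proof -
  let ?P = "u \<noteq> [] \<and> v \<noteq> []"
  have inner: "Poly_Mapping.lookup (\<Sum>i\<in>cuts w. RR (pack (take i w)) (pack (drop i w))) (u, v)
    = (if ?P \<and> w \<in> cut_prod c u v then (1::'k) else 0)" if w: "packed w" for w
  proof -
    have "Poly_Mapping.lookup (\<Sum>i\<in>cuts w. RR (pack (take i w)) (pack (drop i w))) (u, v)
      = (\<Sum>i\<in>cuts w. if i \<in> {i \<in> cuts w. pack (take i w) = u \<and> pack (drop i w) = v} then (1::'k) else 0)"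
      unfolding lookup_sum by (rule sum.cong) (auto simp: RR_def lookup_single when_def)
    \<comment> \<open>A contributing cut must lie at \<open>length u\<close>, so there is at most
      one and the coefficient is 0 or 1.\<close>
    also have "{i \<in> cuts w. pack (take i w) = u \<and> pack (drop i w) = v}
      = (if ?P \<and> w \<in> cut_prod c u v then {length u} else {})" using cuts(2)[OF w] by auto
    also have "(\<Sum>i\<in>cuts w. if i \<in> (if ?P \<and> w \<in> cut_prod c u v then {length u} else {}) then (1::'k) else 0)
      = (if ?P \<and> w \<in> cut_prod c u v then 1 else 0)"
      using cuts(1)[OF w] cuts(2)[OF w, of "length u"] by auto
    finally show ?thesis .
  qed
  have "Poly_Mapping.lookup (lin_ext (\<lambda>w. \<Sum>i\<in>cuts w. RR (pack (take i w)) (pack (drop i w))) f) (u, v)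
    = (\<Sum>w\<in>PW n. if ?P \<and> w \<in> cut_prod c u v then Poly_Mapping.lookup f w else 0)"
    unfolding lin_ext_superset[OF finite_PW f] lookup_sum lookup_fscale
    by (rule sum.cong[OF refl], subst inner[unfolded lookup_sum]) (auto simp: PW_def)
  also have "\<dots> = (if ?P then sum (Poly_Mapping.lookup f) (PW n \<inter> cut_prod c u v) else 0)"
    by (simp add: sum.inter_restrict finite_PW)
  also have "\<dots> = (if ?P \<and> length u + length v = n then sum (Poly_Mapping.lookup f) (cut_prod c u v) else 0)"
  proof (cases "length u + length v = n")
    case True
    then have "PW n \<inter> cut_prod c u v = cut_prod c u v" using cut_prod_subset by blast
    then show ?thesis using True by simp
  next
    case False
    then have "PW n \<inter> cut_prod c u v = {}" using cut_prod_factors(3) by (fastforce simp: PW_def)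
    then show ?thesis using False by simp
  qed
  finally show ?thesis by simp
qed

lemma lookup_Delta:
  fixes f :: "nat list \<Rightarrow>\<^sub>0 'k::field"
  assumes f: "Poly_Mapping.keys f \<subseteq> PW n"
  shows "Poly_Mapping.lookup (Delta_prec f) (u, v) =
      (if u \<noteq> [] \<and> v \<noteq> [] \<and> length u + length v = n then sum (Poly_Mapping.lookup f) (prec_prod u v) else 0)"
    and "Poly_Mapping.lookup (Delta_succ f) (u, v) =
      (if u \<noteq> [] \<and> v \<noteq> [] \<and> length u + length v = n then sum (Poly_Mapping.lookup f) (succ_prod u v) else 0)"
  unfolding Delta_prec_def Delta_succ_def
  by (rule lookup_lin_ext_cuts[OF f], simp add: left_cuts_def, rule pack_cut_iff, assumption)
    (rule lookup_lin_ext_cuts[OF f], simp add: right_cuts_def, rule pack_cut_iff, assumption)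

text \<open>A nonempty right factor has a positive maximum, different from that of the left factor
  by disjointness. So the two strict comparisons partition the terms, the cut position being fixed
  by \<open>length u\<close>.\<close>

lemma sum_full_prod:
  assumes "v \<noteq> []"
  shows "sum f (full_prod u v) = sum f (prec_prod u v) + sum f (succ_prod u v)"
proof -
  have "wmax p \<noteq> wmax q" if "packed (p @ q)" "set p \<inter> set q = {}" "pack q = v" for p q
  proof -
    have "q \<noteq> []" using that(3) assms by (auto simp: pack_def)
    then have "hd q \<in> set q" by simp
    moreover from this have "hd q \<noteq> 0" using packed_pos[OF that(1)] by (metis Un_iff set_append)
    ultimately have "wmax q \<noteq> 0" using le_wmax[of "hd q" q] by auto
    then have "wmax q \<in> set q" using wmax_in[of q] by auto
    then show ?thesis using wmax_in[of p] that(2) \<open>wmax q \<noteq> 0\<close> by auto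
  qed
  then have "full_prod u v = prec_prod u v \<union> succ_prod u v"
    unfolding cut_prod_def by (auto simp: nat_neq_iff) blast+
  moreover have "prec_prod u v \<inter> succ_prod u v = {}"
  proof -
    have False if prec: "w \<in> prec_prod u v" and succ: "w \<in> succ_prod u v" for w
    proof -
      obtain p q where "w = p @ q" "wmax q < wmax p" "length p = length u"
        using prec by (auto simp: cut_prod_def)
      moreover obtain p' q' where "w = p' @ q'" "wmax p' < wmax q'" "length p' = length u"
        using succ by (auto simp: cut_prod_def)
      ultimately show False by auto
    qed
    then show ?thesis by blast
  qed
  ultimately show ?thesis by (simp add: sum.union_disjoint)
qed

lemma tensor_eq_0_iff: "F = 0 \<longleftrightarrow> (\<forall>u v. Poly_Mapping.lookup F (u, v) = 0)"
  by (auto simp: poly_mapping_eq_iff fun_eq_iff)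

lemma Prim_dual_eq:
  assumes "0 < n"
  shows "Prim_dual n = {f :: nat list \<Rightarrow>\<^sub>0 'k::field. Poly_Mapping.keys f \<subseteq> PW n \<and>
     (\<forall>u v. u \<noteq> [] \<and> v \<noteq> [] \<and> length u + length v = n \<longrightarrow>
        sum (Poly_Mapping.lookup f) (full_prod u v) = 0)}"
proof -
  have "Delta_prec f + Delta_succ f = 0 \<longleftrightarrow> (\<forall>u v. u \<noteq> [] \<and> v \<noteq> [] \<and> length u + length v = n \<longrightarrow>
      sum (Poly_Mapping.lookup f) (full_prod u v) = 0)" if "Poly_Mapping.keys f \<subseteq> PW n"
    for f :: "nat list \<Rightarrow>\<^sub>0 'k"
  proof -
    have "Poly_Mapping.lookup (Delta_prec f + Delta_succ f) (u, v) =
      (if u \<noteq> [] \<and> v \<noteq> [] \<and> length u + length v = n then sum (Poly_Mapping.lookup f) (full_prod u v) else 0)"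
      for u v by (simp add: lookup_add lookup_Delta[OF that] sum_full_prod)
    then show ?thesis unfolding tensor_eq_0_iff by presburger
  qed
  then show ?thesis using assms unfolding Prim_dual_def WQSym_dual_eq by auto
qed

lemma TPrim_dual_eq:
  assumes "0 < n"
  shows "TPrim_dual n = {f :: nat list \<Rightarrow>\<^sub>0 'k::field. Poly_Mapping.keys f \<subseteq> PW n \<and>
     (\<forall>u v. u \<noteq> [] \<and> v \<noteq> [] \<and> length u + length v = n \<longrightarrow>
        sum (Poly_Mapping.lookup f) (prec_prod u v) = 0 \<and> sum (Poly_Mapping.lookup f) (succ_prod u v) = 0)}"
proof -
  have "Delta_prec f = 0 \<and> Delta_succ f = 0 \<longleftrightarrow> (\<forall>u v. u \<noteq> [] \<and> v \<noteq> [] \<and> length u + length v = n \<longrightarrow>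
      sum (Poly_Mapping.lookup f) (prec_prod u v) = 0 \<and> sum (Poly_Mapping.lookup f) (succ_prod u v) = 0)"
    if "Poly_Mapping.keys f \<subseteq> PW n" for f :: "nat list \<Rightarrow>\<^sub>0 'k"
  proof -
    have "Delta_prec f = 0 \<longleftrightarrow> (\<forall>u v. u \<noteq> [] \<and> v \<noteq> [] \<and> length u + length v = n \<longrightarrow>
        sum (Poly_Mapping.lookup f) (prec_prod u v) = 0)"
      "Delta_succ f = 0 \<longleftrightarrow> (\<forall>u v. u \<noteq> [] \<and> v \<noteq> [] \<and> length u + length v = n \<longrightarrow>
        sum (Poly_Mapping.lookup f) (succ_prod u v) = 0)"
      unfolding tensor_eq_0_iff lookup_Delta[OF that] by presburger+
    then show ?thesis by blast
  qed
  then show ?thesis using assms unfolding TPrim_dual_def WQSym_dual_eq by auto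
qed

section \<open>Dimensions\<close>

lemma sum_leading_zero:
  fixes g :: "nat list \<Rightarrow> 'k::ab_group_add"
  assumes "finite S" "sum g S = 0" "r \<in> S" "\<And>x. x \<in> S \<Longrightarrow> x \<noteq> r \<Longrightarrow> g x = 0"
  shows "g r = 0"
  using assms by (simp add: sum.remove[of S r])

text \<open>Induction on the inversions of \<open>u\<close>, the leading term of [t] * ts. By
  associativity ([t] * ts) * v = [t] * (ts * v), where the right side is a sum of pivot equations;
  on the left all terms but \<open>u\<close> vanish by induction.\<close>

lemma full_prod_equations_span:
  fixes f :: "nat list \<Rightarrow> 'k::field"
  assumes piv: "\<And>t ts. red_packed_forest (t # ts) \<Longrightarrow> ts \<noteq> [] \<Longrightarrow> forest_weight (t # ts) = n \<Longrightarrow>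
      sum f (full_prod (forest_word [t]) (forest_word ts)) = 0"
    and "u \<noteq> []" "v \<noteq> []" "length u + length v = n"
  shows "sum f (full_prod u v) = 0"
proof (cases "packed u \<and> packed v")
  case False
  then have "full_prod u v = {}" using cut_prod_factors(4,5) by blast
  then show ?thesis by simp
next
  case True
  \<comment> \<open>Every packed word is a forest word, so the second factor of a pivot equation may
    be any nonempty packed word.\<close>
  have piv': "sum f (full_prod (forest_word [t]) y) = 0"
    if "red_packed t" "packed y" "y \<noteq> []" "weight t + length y = n" for t y
  proof -
    obtain us where "red_packed_forest us" "forest_word us = y" using forest_word_surj[OF \<open>packed y\<close>] .
    moreover from this have "us \<noteq> []" using that(3) by auto
    ultimately show ?thesis using piv[of t us] that by auto
  qed
  from True assms(2,4) show ?thesis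
  proof (induction "card (inversions u)" arbitrary: u rule: less_induct)
    case less
    obtain F where F: "red_packed_forest F" "forest_word F = u" using forest_word_surj less(2) by blast
    then obtain t ts where tts: "F = t # ts" using less(3) by (cases F) auto
    have t: "red_packed t" "length u = weight t + forest_weight ts"
      using F tts length_forest_word[of F] by auto
    show ?case
    proof (cases "ts = []")
      case True
      then show ?thesis using piv'[of t v] t F tts less assms(3) by simp
    next
      case False
      let ?S = "full_prod (forest_word [t]) (forest_word ts)"
      have "sum f (full_prod (forest_word [t]) y) = 0" if "y \<in> full_prod (forest_word ts) v" for y
        using cut_prod_factors(3,6)[OF that] t less(4) assms(3) by (intro piv') auto
      then have "(\<Sum>x\<in>?S. sum f (full_prod x v)) = 0" unfolding sum_full_assoc by simp
      moreover have "sum f (full_prod x v) = 0" if "x \<in> ?S" "x \<noteq> u" for x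
      proof (rule less(1))
        show "card (inversions x) < card (inversions u)"
          using forest_word_Cons_leading(2)[of t ts x] F tts that by auto
        show "packed x \<and> packed v" using cut_prod_factors(6)[OF that(1)] less(2) by simp
        have l: "length x = length u" using cut_prod_factors(3)[OF that(1)] t by simp
        show "x \<noteq> []" "length x + length v = n" using l less(3,4) by auto
      qed
      moreover have "u \<in> ?S" using forest_word_Cons_leading(1)[of t ts] F tts by simp
      ultimately show ?thesis by (intro sum_leading_zero[of ?S "\<lambda>x. sum f (full_prod x v)" u]) auto
    qed
  qed
qed

text \<open>The same elimination with \<open>u\<close>, respectively \<open>v\<close>, as the
  leading term of a \<succ> t \<prec> b. The other factor is absorbed into \<open>b\<close>,
  respectively \<open>a\<close>, by \<open>sum_mid_prec\<close> and \<open>sum_succ_mid\<close>,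
  which leaves pivot equations.\<close>

lemma dendriform_equations_span:
  fixes f :: "nat list \<Rightarrow> 'k::field"
  assumes piv: "\<And>I ls rs ts. red_packed_forest (Node I ls rs # ts) \<Longrightarrow> ls \<noteq> [] \<or> ts \<noteq> [] \<Longrightarrow>
      forest_weight (Node I ls rs # ts) = n \<Longrightarrow>
      sum f (mid_prod (forest_word ls) (forest_word [Node I [] rs]) (forest_word ts)) = 0"
    and uv: "u \<noteq> []" "v \<noteq> []" "length u + length v = n"
  shows "sum f (prec_prod u v) = 0" "sum f (succ_prod u v) = 0"
proof -
  have piv': "sum f (mid_prod a (forest_word [Node I [] rs]) b) = 0"
    if "red_packed (Node I [] rs)" "packed a" "packed b" "a \<noteq> [] \<or> b \<noteq> []"
      "length a + weight (Node I [] rs) + length b = n" for a b I rs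
  proof -
    obtain ls where ls: "red_packed_forest ls" "forest_word ls = a" using forest_word_surj[OF \<open>packed a\<close>] .
    obtain ts where ts: "red_packed_forest ts" "forest_word ts = b" using forest_word_surj[OF \<open>packed b\<close>] .
    \<comment> \<open>Any red-packed left forest may be attached, as the label condition does not
      involve it.\<close>
    have "red_packed (Node I ls rs)" using that(1) ls(1) unfolding red_packed_Node by blast
    then have "red_packed_forest (Node I ls rs # ts)" using ts(1) by simp
    moreover have "ls \<noteq> [] \<or> ts \<noteq> []" using that(4) ls(2) ts(2) by auto
    moreover have "forest_weight (Node I ls rs # ts) = n"
      using that(5) ls(2) ts(2) by (auto simp: weight_Node)
    ultimately show ?thesis using piv[of I ls rs ts] ls(2) ts(2) by simp
  qed
  have dec: "\<exists>I rs a b. red_packed (Node I [] rs) \<and> packed a \<and> packed b \<and>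
      length w = length a + weight (Node I [] rs) + length b \<and>
      w \<in> mid_prod a (forest_word [Node I [] rs]) b \<and>
      (\<forall>x \<in> mid_prod a (forest_word [Node I [] rs]) b. x \<noteq> w \<longrightarrow> packed x \<and> length x = length w \<and>
         card (inversions x) < card (inversions w))" if "packed w" "w \<noteq> []" for w
  proof -
    obtain F where F: "red_packed_forest F" "forest_word F = w" using forest_word_surj[OF \<open>packed w\<close>] .
    then obtain t ts where "F = t # ts" using \<open>w \<noteq> []\<close> by (cases F) auto
    moreover obtain I ls rs where "t = Node I ls rs" by (cases t)
    ultimately have e: "F = Node I ls rs # ts" by simp
    have N: "red_packed (Node I ls rs)" using F e by simp
    then have N0: "red_packed (Node I [] rs)" by (rule red_packed_NodeD)
    have p: "packed (forest_word ls)" "packed (forest_word ts)"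
      using F(1) e red_packed_NodeD(2)[OF N] by (simp_all add: packed_forest_word)
    have l: "length w = length (forest_word ls) + weight (Node I [] rs) + length (forest_word ts)"
      using F(2)[symmetric] e by (simp add: weight_Node)
    have x: "packed x" "length x = length w"
      if "x \<in> mid_prod (forest_word ls) (forest_word [Node I [] rs]) (forest_word ts)" for x
      using cut_prod3_subset[THEN subsetD, OF that] l by (auto simp: PW_def)
    have "card (inversions x) < card (inversions w)"
      if "x \<in> mid_prod (forest_word ls) (forest_word [Node I [] rs]) (forest_word ts)" "x \<noteq> w" for x
      using forest_word_Node_leading(2)[of I ls rs ts x] F e that by auto
    moreover have "w \<in> mid_prod (forest_word ls) (forest_word [Node I [] rs]) (forest_word ts)"
      using forest_word_Node_leading(1)[of I ls rs ts] F e by auto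
    ultimately show ?thesis using N0 p l x by blast
  qed
  show "sum f (prec_prod u v) = 0"
  proof (cases "packed u \<and> packed v")
    case False
    then have "prec_prod u v = {}" using cut_prod_factors(4,5) by blast
    then show ?thesis by simp
  next
    case True
    then show ?thesis using uv(1,3)
    proof (induction "card (inversions u)" arbitrary: u rule: less_induct)
      case less
      then obtain I rs a b where d: "red_packed (Node I [] rs)" "packed a" "packed b"
        "length u = length a + weight (Node I [] rs) + length b"
        "u \<in> mid_prod a (forest_word [Node I [] rs]) b"
        "\<And>x. x \<in> mid_prod a (forest_word [Node I [] rs]) b \<Longrightarrow> x \<noteq> u \<Longrightarrow> packed x \<and> length x = length u \<and>
           card (inversions x) < card (inversions u)"
        using dec[of u] by blast
      let ?S = "mid_prod a (forest_word [Node I [] rs]) b"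
      \<comment> \<open>Since \<open>v\<close> is nonempty, so is every term of
        \<open>full_prod b v\<close>; this meets the side condition of the pivot equations.\<close>
      have "sum f (mid_prod a (forest_word [Node I [] rs]) y) = 0" if "y \<in> full_prod b v" for y
        using cut_prod_factors(3,6)[OF that] d less(4) uv(2) by (intro piv') auto
      then have "(\<Sum>x\<in>?S. sum f (prec_prod x v)) = 0" unfolding sum_mid_prec by simp
      moreover have "sum f (prec_prod x v) = 0" if "x \<in> ?S" "x \<noteq> u" for x
        using d(6)[OF that] less(2-4) by (intro less(1)) auto
      ultimately show ?case using d(5)
        by (intro sum_leading_zero[of ?S "\<lambda>x. sum f (prec_prod x v)" u]) auto
    qed
  qed
  show "sum f (succ_prod u v) = 0"
  proof (cases "packed u \<and> packed v")
    case False
    then have "succ_prod u v = {}" using cut_prod_factors(4,5) by blast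
    then show ?thesis by simp
  next
    case True
    then show ?thesis using uv(2,3)
    proof (induction "card (inversions v)" arbitrary: v rule: less_induct)
      case less
      then obtain I rs a b where d: "red_packed (Node I [] rs)" "packed a" "packed b"
        "length v = length a + weight (Node I [] rs) + length b"
        "v \<in> mid_prod a (forest_word [Node I [] rs]) b"
        "\<And>x. x \<in> mid_prod a (forest_word [Node I [] rs]) b \<Longrightarrow> x \<noteq> v \<Longrightarrow> packed x \<and> length x = length v \<and>
           card (inversions x) < card (inversions v)"
        using dec[of v] by blast
      let ?S = "mid_prod a (forest_word [Node I [] rs]) b"
      have "sum f (mid_prod x (forest_word [Node I [] rs]) b) = 0" if "x \<in> full_prod u a" for x
        using cut_prod_factors(3,6)[OF that] d less(4) uv(1) by (intro piv') auto
      then have "(\<Sum>y\<in>?S. sum f (succ_prod u y)) = 0" unfolding sum_succ_mid by simp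
      moreover have "sum f (succ_prod u x) = 0" if "x \<in> ?S" "x \<noteq> v" for x
        using d(6)[OF that] less(2-4) by (intro less(1)) auto
      ultimately show ?case using d(5)
        by (intro sum_leading_zero[of ?S "\<lambda>x. sum f (succ_prod u x)" v]) auto
    qed
  qed
qed

text \<open>Choose the bracketing whose outer half-product has two nonempty factors: (a \<succ> t)
  \<prec> b if \<open>b\<close> is nonempty, a \<succ> (t \<prec> b) otherwise.\<close>

lemma mid_prod_equations:
  fixes f :: "nat list \<Rightarrow> 'k::field"
  assumes eqs: "\<And>u v. u \<noteq> [] \<Longrightarrow> v \<noteq> [] \<Longrightarrow> length u + length v = n \<Longrightarrow>
      sum f (prec_prod u v) = 0 \<and> sum f (succ_prod u v) = 0"
    and "t \<noteq> []" "a \<noteq> [] \<or> b \<noteq> []" "length a + length t + length b = n"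
  shows "sum f (mid_prod a t b) = 0"
proof (cases "b = []")
  case False
  have "sum f (prec_prod x b) = 0" if "x \<in> succ_prod a t" for x
    using cut_prod_factors(3)[OF that] assms False by (intro eqs[THEN conjunct1]) auto
  then show ?thesis unfolding sum_mid_left by simp
next
  case True
  have "sum f (succ_prod a y) = 0" if "y \<in> prec_prod t b" for y
    using cut_prod_factors(3)[OF that] assms True by (intro eqs[THEN conjunct2]) auto
  then show ?thesis unfolding sum_mid_right by simp
qed

section \<open>Counting the forests that are not pivots\<close>

lemma card_PW_minus_forest_words:
  assumes "X \<subseteq> {ts. red_packed_forest ts \<and> forest_weight ts = n}"
  shows "card (PW n - forest_word ` X) = card ({ts. red_packed_forest ts \<and> forest_weight ts = n} - X)"
proof -
  let ?F = "{ts. red_packed_forest ts \<and> forest_weight ts = n}"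
  have inj: "inj_on forest_word ?F" and im: "forest_word ` ?F = PW n"
    using forest_word_bij[of n] by (auto simp: bij_betw_def)
  have "PW n - forest_word ` X = forest_word ` (?F - X)"
    unfolding im[symmetric] using inj_on_image_set_diff[OF inj, of ?F X] assms by auto
  then show ?thesis using inj_on_subset[OF inj, of "?F - X"] by (simp add: card_image)
qed

lemma dim_WQSym_dual:
  "free_vs.dim (WQSym_dual n :: (nat list \<Rightarrow>\<^sub>0 'k::field) set)
    = card {ts. red_packed_forest ts \<and> forest_weight ts = n}"
  unfolding WQSym_dual_eq dim_keys_subset using card_PW_minus_forest_words[of "{}" n] by simp

lemma dim_Prim_dual:
  assumes "0 < n"
  shows "free_vs.dim (Prim_dual n :: (nat list \<Rightarrow>\<^sub>0 'k::field) set) = card {t. red_packed t \<and> weight t = n}"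
proof -
  let ?F = "{ts. red_packed_forest ts \<and> forest_weight ts = n}"
  \<comment> \<open>The pivots are the forests with at least two trees; each gives the equation that
    splits off its first tree.\<close>
  define X where "X = {ts \<in> ?F. tl ts \<noteq> []}"
  let ?S = "\<lambda>ts. full_prod (forest_word [hd ts]) (forest_word (tl ts))"
  have X: "\<exists>t us. ts = t # us \<and> us \<noteq> [] \<and> red_packed_forest (t # us) \<and> forest_weight (t # us) = n"
    if "ts \<in> X" for ts using that by (cases ts) (auto simp: X_def)
  have "Prim_dual n = {f :: nat list \<Rightarrow>\<^sub>0 'k. Poly_Mapping.keys f \<subseteq> PW n \<and>
      (\<forall>ts\<in>X. sum (Poly_Mapping.lookup f) (?S ts) = 0)}"
  proof -
    have "(\<forall>u v. u \<noteq> [] \<and> v \<noteq> [] \<and> length u + length v = n \<longrightarrow> sum g (full_prod u v) = 0) \<longleftrightarrow>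
        (\<forall>ts\<in>X. sum g (?S ts) = 0)" (is "?A \<longleftrightarrow> ?B") for g :: "nat list \<Rightarrow> 'k"
    proof
      assume A: ?A
      show ?B
      proof
        fix ts assume "ts \<in> X"
        then obtain t us where ts: "ts = t # us" "us \<noteq> []" "red_packed_forest (t # us)"
          "forest_weight (t # us) = n" using X by blast
        then have "forest_word [t] \<noteq> []" "forest_word us \<noteq> []"
          by (simp_all add: forest_word_eq_Nil_iff)
        then show "sum g (?S ts) = 0" using A ts by simp
      qed
    next
      assume B: ?B
      have "sum g (full_prod (forest_word [t]) (forest_word ts)) = 0"
        if "red_packed_forest (t # ts)" "ts \<noteq> []" "forest_weight (t # ts) = n" for t ts
        using B[rule_format, of "t # ts"] that by (simp add: X_def)
      then show ?A using full_prod_equations_span[of n g] by blast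
    qed
    then show ?thesis unfolding Prim_dual_eq[OF assms] by simp
  qed
  moreover have "free_vs.dim {f :: nat list \<Rightarrow>\<^sub>0 'k. Poly_Mapping.keys f \<subseteq> PW n \<and>
      (\<forall>ts\<in>X. sum (Poly_Mapping.lookup f) (?S ts) = 0)} = card (PW n - forest_word ` X)"
  proof (rule dim_triangular_system_indexed[where rk = "\<lambda>w. card (inversions w)", OF finite_PW])
    show "inj_on forest_word X" "forest_word ` X \<subseteq> PW n"
      using forest_word_bij[of n] by (auto simp: bij_betw_def X_def intro: inj_on_subset)
    fix ts assume "ts \<in> X"
    then obtain t us where ts: "ts = t # us" "red_packed_forest (t # us)"
      "forest_weight (t # us) = n" using X by blast
    show "forest_word ts \<in> ?S ts" using forest_word_Cons_leading(1) ts by simp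
    show "?S ts \<subseteq> PW n" using cut_prod_subset[of _ "forest_word [t]" "forest_word us"] ts by simp
    show "card (inversions x) < card (inversions (forest_word ts))" if "x \<in> ?S ts - {forest_word ts}" for x
      using forest_word_Cons_leading(2)[of t us x] ts that by simp
  qed
  moreover have "card (PW n - forest_word ` X) = card (?F - X)"
    by (rule card_PW_minus_forest_words) (auto simp: X_def)
  \<comment> \<open>Positive weight excludes the empty forest, so exactly the one-tree forests
    remain.\<close>
  moreover have "?F - X = (\<lambda>t. [t]) ` {t. red_packed t \<and> weight t = n}"
  proof (intro equalityI subsetI)
    fix ts assume "ts \<in> ?F - X"
    then show "ts \<in> (\<lambda>t. [t]) ` {t. red_packed t \<and> weight t = n}"
      using assms by (cases ts) (auto simp: X_def)
  qed (auto simp: X_def)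
  ultimately show ?thesis by (simp add: card_image inj_on_def)
qed

lemma dim_TPrim_dual:
  assumes "0 < n"
  shows "free_vs.dim (TPrim_dual n :: (nat list \<Rightarrow>\<^sub>0 'k::field) set)
    = card {t. red_packed t \<and> weight t = n \<and> left_forest t = []}"
proof -
  let ?F = "{ts. red_packed_forest ts \<and> forest_weight ts = n}"
  define X where "X = {ts \<in> ?F. left_forest (hd ts) \<noteq> [] \<or> tl ts \<noteq> []}"
  let ?S = "\<lambda>ts. mid_prod (forest_word (left_forest (hd ts)))
    (forest_word [Node (root_label (hd ts)) [] (right_forest (hd ts))]) (forest_word (tl ts))"
  have X: "\<exists>I ls rs us. ts = Node I ls rs # us \<and> (ls \<noteq> [] \<or> us \<noteq> []) \<and>
      red_packed_forest (Node I ls rs # us) \<and> forest_weight (Node I ls rs # us) = n"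
    if "ts \<in> X" for ts
  proof (cases ts)
    case Nil
    \<comment> \<open>\<open>hd []\<close> is unspecified, but a forest of positive weight is
      nonempty.\<close>
    then show ?thesis using that assms by (simp add: X_def)
  next
    case (Cons t us)
    then show ?thesis using that by (cases t) (auto simp: X_def)
  qed
  have "TPrim_dual n = {f :: nat list \<Rightarrow>\<^sub>0 'k. Poly_Mapping.keys f \<subseteq> PW n \<and>
      (\<forall>ts\<in>X. sum (Poly_Mapping.lookup f) (?S ts) = 0)}"
  proof -
    have "(\<forall>u v. u \<noteq> [] \<and> v \<noteq> [] \<and> length u + length v = n \<longrightarrow>
          sum g (prec_prod u v) = 0 \<and> sum g (succ_prod u v) = 0) \<longleftrightarrow>
        (\<forall>ts\<in>X. sum g (?S ts) = 0)" (is "?A \<longleftrightarrow> ?B") for g :: "nat list \<Rightarrow> 'k"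
    proof
      assume A: ?A
      show ?B
      proof
        fix ts assume "ts \<in> X"
        then obtain I ls rs us where ts: "ts = Node I ls rs # us" "ls \<noteq> [] \<or> us \<noteq> []"
          "red_packed_forest (Node I ls rs # us)" "forest_weight (Node I ls rs # us) = n" using X by blast
        have "sum g (mid_prod (forest_word ls) (forest_word [Node I [] rs]) (forest_word us)) = 0"
        proof (rule mid_prod_equations[where n = n])
          show "forest_word [Node I [] rs] \<noteq> []" 
            using red_packed_NodeD(1)[of I ls rs] ts(3) by (simp add: forest_word_eq_Nil_iff)
          show "forest_word ls \<noteq> [] \<or> forest_word us \<noteq> []" 
            using red_packed_NodeD(2)[of I ls rs] ts(2,3) by (auto simp: forest_word_eq_Nil_iff)
          show "length (forest_word ls) + length (forest_word [Node I [] rs]) + length (forest_word us) = n"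
            using ts(4) by (simp add: weight_Node)
        qed (use A in blast)
        then show "sum g (?S ts) = 0" using ts by simp
      qed
    next
      assume B: ?B
      have "sum g (mid_prod (forest_word ls) (forest_word [Node I [] rs]) (forest_word ts)) = 0"
        if "red_packed_forest (Node I ls rs # ts)" "ls \<noteq> [] \<or> ts \<noteq> []"
          "forest_weight (Node I ls rs # ts) = n" for I ls rs ts
        using B[rule_format, of "Node I ls rs # ts"] that by (simp add: X_def)
      then show ?A using dendriform_equations_span[of n g] by blast
    qed
    then show ?thesis unfolding TPrim_dual_eq[OF assms] by simp
  qed
  moreover have "free_vs.dim {f :: nat list \<Rightarrow>\<^sub>0 'k. Poly_Mapping.keys f \<subseteq> PW n \<and>
      (\<forall>ts\<in>X. sum (Poly_Mapping.lookup f) (?S ts) = 0)} = card (PW n - forest_word ` X)"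
  proof (rule dim_triangular_system_indexed[where rk = "\<lambda>w. card (inversions w)", OF finite_PW])
    show "inj_on forest_word X" "forest_word ` X \<subseteq> PW n"
      using forest_word_bij[of n] by (auto simp: bij_betw_def X_def intro: inj_on_subset)
    fix ts assume "ts \<in> X"
    then obtain I ls rs us where ts: "ts = Node I ls rs # us"
      "red_packed_forest (Node I ls rs # us)" "forest_weight (Node I ls rs # us) = n" using X by blast
    show "forest_word ts \<in> ?S ts" using forest_word_Node_leading(1)[of I ls rs us] ts by simp
    show "?S ts \<subseteq> PW n"
      using cut_prod3_subset[of _ "forest_word ls" "forest_word [Node I [] rs]" "forest_word us"] ts
      by (simp add: weight_Node ac_simps)
    show "card (inversions x) < card (inversions (forest_word ts))" if "x \<in> ?S ts - {forest_word ts}" for x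
      using forest_word_Node_leading(2)[of I ls rs us x] ts that by simp
  qed
  moreover have "card (PW n - forest_word ` X) = card (?F - X)"
    by (rule card_PW_minus_forest_words) (auto simp: X_def)
  moreover have "?F - X = (\<lambda>t. [t]) ` {t. red_packed t \<and> weight t = n \<and> left_forest t = []}"
  proof (intro equalityI subsetI)
    fix ts assume "ts \<in> ?F - X"
    then show "ts \<in> (\<lambda>t. [t]) ` {t. red_packed t \<and> weight t = n \<and> left_forest t = []}"
      using assms by (cases ts) (auto simp: X_def)
  qed (auto simp: X_def)
  ultimately show ?thesis by (simp add: card_image inj_on_def)
qed

theorem mainTheorem1:
  fixes n :: nat
  shows "free_vs.dim (WQSym_dual n :: (nat list \<Rightarrow>\<^sub>0 'k::field) set)
           = card {ts. red_packed_forest ts \<and> forest_weight ts = n}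
       \<and> free_vs.dim (Prim_dual n :: (nat list \<Rightarrow>\<^sub>0 'k) set)
           = card {t. red_packed t \<and> weight t = n}
       \<and> free_vs.dim (TPrim_dual n :: (nat list \<Rightarrow>\<^sub>0 'k) set)
           = card {t. red_packed t \<and> weight t = n \<and> left_forest t = []}"
proof (cases "n = 0")
  case True
  \<comment> \<open>In degree 0 both primitive spaces are zero by convention, matching the absence
    of trees of weight 0.\<close>
  have "\<not> (red_packed t \<and> weight t = 0)" for t using red_packed_weight_pos by auto
  then have "{t. red_packed t \<and> weight t = 0} = {}"
    and "{t. red_packed t \<and> weight t = 0 \<and> left_forest t = []} = {}" by blast+
  moreover have "free_vs.dim ({0} :: (nat list \<Rightarrow>\<^sub>0 'k) set) = 0"
    using dim_keys_subset[where A = "{} :: nat list set" and 'k = 'k] by simp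
  ultimately show ?thesis using True dim_WQSym_dual[of n]
    by (simp only: Prim_dual_def TPrim_dual_def if_True card.empty simp_thms)
next
  case False
  then show ?thesis using dim_WQSym_dual[of n] dim_Prim_dual[of n] dim_TPrim_dual[of n] by simp
qed

end
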